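(* Let $\alpha\in\mathbb{R}\setminus\mathbb{Q}$, let $\mathfrak{p}:\mathbb{T}\to(0,1)$ be a continuous function, $\mathfrak{q}=1-\mathfrak{p}$. Assume that $\mathfrak{p}$ is symmetric, i.e. $\int_{\mathbb{T}}\log\frac{\mathfrak{p}(y)}{\mathfrak{q}(y)}\,dy=0$, and that $y\mapsto\log\frac{\mathfrak{p}(y)}{\mathfrak{q}(y)}$ is continuous and of bounded variation on $\mathbb{T}$. Let $x\in\mathbb{T}$. If $$\sum_{k\in\mathbb{Z}}\mathbb{P}_x(\mathcal{T}_k=n)\to 0\quad\text{as } n\to\infty,$$ then for every continuous $\varphi:\mathbb{T}\to\mathbb{R}$, $$\mathbb{E}_x\varphi(X_n)\to\int_{\mathbb{T}}\varphi\,d\mu_\ast\quad\text{as } n\to\infty,$$ where $\mu_\ast$ is the unique stationary Borel probability measure of the Markov process $(X_n)$.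
   Context: $\mathbb{T}=\mathbb{R}/\mathbb{Z}$ is the circle. $(X_n)$ is the Markov process on $\mathbb{T}$ with transition kernel $p(y,\cdot)=\mathfrak{p}(y)\delta_{y+\alpha}+\mathfrak{q}(y)\delta_{y-\alpha}$; $\mathbb{E}_x\varphi(X_n)$ denotes the expectation when $X_0=x$. A Borel probability measure $\mu$ on $\mathbb{T}$ is stationary if $\mathbb{E}_\mu\varphi(X_n)=\mathbb{E}_\mu\varphi(X_0)$ for every continuous $\varphi$ and $n\ge0$, where $\mathbb{E}_\mu$ is expectation when $X_0$ has distribution $\mu$; under the hypotheses here $(X_n)$ has exactly one stationary Borel probability measure, denoted $\mu_\ast$. For $x\in\mathbb{T}$, $(\xi_n)_{n\ge0}$ under $\mathbb{P}_x$ is the nearest neighbour random walk (Markov chain) on $\mathbb{Z}$ with $\xi_0=0$ and $\mathbb{P}_x(\xi_{n+1}=k+1\mid\xi_n=k)=\mathfrak{p}(x+k\alpha)$, $\mathbb{P}_x(\xi_{n+1}=k-1\mid\xi_n=k)=\mathfrak{q}(x+k\alpha)$ for $k\in\mathbb{Z}$, $n\ge0$. The $k$-th ladder moment is $\mathcal{T}_k=\min\{j\ge0:\xi_j=k\}$, $k\in\mathbb{Z}$. *)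

theory Defs
  imports "HOL-Probability.Probability"
begin

section \<open>The circle \<open>\<real>/\<int>\<close>\<close>

quotient_type circle = real / "\<lambda>x y. x - y \<in> \<int>"
  morphisms rep_circle to_circle
proof (rule equivpI)
  show "reflp (\<lambda>x y :: real. x - y \<in> \<int>)"
    by (auto simp: reflp_def)
  show "symp (\<lambda>x y :: real. x - y \<in> \<int>)"
    unfolding symp_def by (metis Ints_minus minus_diff_eq)
  show "transp (\<lambda>x y :: real. x - y \<in> \<int>)"
    unfolding transp_def by (metis Ints_add diff_add_cancel add_diff_eq)
qed

instantiation circle :: ab_group_add
begin

lift_definition zero_circle :: circle is "0 :: real" .

lift_definition plus_circle :: "circle \<Rightarrow> circle \<Rightarrow> circle" is "(+) :: real \<Rightarrow> real \<Rightarrow> real"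
  by (metis Ints_add add_diff_add)

lift_definition minus_circle :: "circle \<Rightarrow> circle \<Rightarrow> circle" is "(-) :: real \<Rightarrow> real \<Rightarrow> real"
proof -
  fix a b c d :: real
  assume "a - b \<in> \<int>" "c - d \<in> \<int>"
  then have "(a - b) - (c - d) \<in> \<int>" by (rule Ints_diff)
  then show "a - c - (b - d) \<in> \<int>" by (simp add: algebra_simps)
qed

lift_definition uminus_circle :: "circle \<Rightarrow> circle" is "uminus :: real \<Rightarrow> real"
  by (metis Ints_minus minus_diff_minus)

instance
  by standard (transfer; simp)+

end

text \<open>The quotient topology.\<close>

instantiation circle :: topological_space
begin

definition open_circle :: "circle set \<Rightarrow> bool"
  where "open_circle U \<longleftrightarrow> open (to_circle -` U)"

instance
proof
  show "open (UNIV :: circle set)"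
    by (simp add: open_circle_def)
  show "open (S \<inter> T)" if "open S" "open T" for S T :: "circle set"
    using that by (simp add: open_circle_def vimage_Int open_Int)
  show "open (\<Union>K)" if "\<forall>S\<in>K. open S" for K :: "circle set set"
    using that by (auto simp: open_circle_def vimage_Union)
qed

end

lemma continuous_on_to_circle: "continuous_on UNIV to_circle"
  by (simp add: continuous_on_open_vimage open_circle_def)

lemma to_circle_add: "to_circle (a + b) = to_circle a + to_circle b"
  by transfer simp

lemma to_circle_surj: "\<exists>r. y = to_circle r"
  by (metis Quotient_circle Quotient_abs_rep)

lemma continuous_on_circle_add: "continuous_on UNIV (\<lambda>y :: circle. y + a)"
proof (subst continuous_on_open_vimage, simp, intro allI impI)
  fix B :: "circle set"
  assume B: "open B"
  obtain r where r: "a = to_circle r"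
    using to_circle_surj by blast
  have "to_circle -` ((\<lambda>y. y + a) -` B) = (\<lambda>t. t + r) -` (to_circle -` B)"
    by (auto simp: r to_circle_add)
  moreover have "open ((\<lambda>t. t + r) -` (to_circle -` B))"
    using B[unfolded open_circle_def] by (rule open_vimage) (auto simp: open_circle_def intro!: continuous_intros)
  ultimately show "open ((\<lambda>y. y + a) -` B \<inter> UNIV)"
    by (simp add: open_circle_def)
qed

definition circle_lebesgue :: "circle measure"
  where "circle_lebesgue = distr (restrict_space lborel {0..<1}) borel to_circle"

text \<open>Partitions \<open>t\<^sub>0 \<le> \<dots> \<le> t\<^sub>n\<close> of an arc are read on the universal cover;
  \<open>t\<^sub>n \<le> t\<^sub>0 + 1\<close> says that they go around the circle at most once.\<close>

definition bounded_variation_circle :: "(circle \<Rightarrow> real) \<Rightarrow> bool"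
  where "bounded_variation_circle f \<longleftrightarrow>
    (\<exists>V. \<forall>n. \<forall>t :: nat \<Rightarrow> real. mono t \<and> t n \<le> t 0 + 1 \<longrightarrow>
      (\<Sum>i<n. \<bar>f (to_circle (t (Suc i))) - f (to_circle (t i))\<bar>) \<le> V)"


section \<open>Path measures of Markov chains\<close>

text \<open>The law on path space of the Markov chain with initial law \<open>\<mu>\<close> and transition kernel \<open>K\<close>,
  obtained from the Ionescu-Tulcea theorem; the chain itself is the coordinate process.\<close>

definition markov_step ::
    "'s measure \<Rightarrow> ('s \<Rightarrow> 's measure) \<Rightarrow> nat \<Rightarrow> (nat \<Rightarrow> 's) \<Rightarrow> 's measure"
  where "markov_step \<mu> K n \<omega> = (case n of 0 \<Rightarrow> \<mu> | Suc m \<Rightarrow> K (\<omega> m))"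

definition markov_law ::
    "'s :: topological_space measure \<Rightarrow> ('s \<Rightarrow> 's measure) \<Rightarrow> (nat \<Rightarrow> 's) measure"
  where "markov_law \<mu> K =
    projective_family.lim UNIV (Ionescu_Tulcea.CI (markov_step \<mu> K) (\<lambda>_. borel)) (\<lambda>_. borel)"

lemma Ionescu_Tulcea_markov_step:
  fixes \<mu> :: "'s :: topological_space measure"
  assumes mu: "prob_space \<mu>" "sets \<mu> = sets borel"
    and K: "K \<in> borel \<rightarrow>\<^sub>M subprob_algebra borel" "\<And>s. prob_space (K s)"
  shows "Ionescu_Tulcea (markov_step \<mu> K) (\<lambda>_. borel)"
proof (rule Ionescu_Tulcea.intro)
  show "markov_step \<mu> K i \<in> PiM {0..<i} (\<lambda>_. borel) \<rightarrow>\<^sub>M subprob_algebra borel" for i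
  proof (cases i)
    case 0
    have "\<mu> \<in> space (subprob_algebra borel)"
      using mu by (simp add: space_subprob_algebra prob_space_imp_subprob_space)
    then show ?thesis
      using 0 by (simp add: markov_step_def[abs_def])
  next
    case (Suc m)
    have "(\<lambda>\<omega>. K (\<omega> m)) \<in> PiM {0..<Suc m} (\<lambda>_. borel) \<rightarrow>\<^sub>M subprob_algebra borel"
      by (rule measurable_compose[where N=borel, OF _ K(1)]) (simp add: measurable_component_singleton)
    then show ?thesis
      by (simp add: markov_step_def[abs_def] Suc)
  qed
  show "prob_space (markov_step \<mu> K i x)" for i x
    using mu K by (auto simp: markov_step_def split: nat.split)
qed

lemma
  fixes \<mu> :: "'s :: topological_space measure"
  assumes mu: "prob_space \<mu>" "sets \<mu> = sets borel"
    and K: "K \<in> borel \<rightarrow>\<^sub>M subprob_algebra borel" "\<And>s. prob_space (K s)"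
  shows sets_markov_law: "sets (markov_law \<mu> K) = sets (PiM UNIV (\<lambda>_. borel))"
    and prob_space_markov_law: "prob_space (markov_law \<mu> K)"
    and markov_law_init: "distr (markov_law \<mu> K) borel (\<lambda>\<omega>. \<omega> 0) = \<mu>"
    and markov_law_Suc: "distr (markov_law \<mu> K) (PiM {0..<Suc (Suc n)} (\<lambda>_. borel))
            (\<lambda>\<omega>. restrict \<omega> {0..<Suc (Suc n)}) =
          distr (markov_law \<mu> K) (PiM {0..<Suc n} (\<lambda>_. borel)) (\<lambda>\<omega>. restrict \<omega> {0..<Suc n}) \<bind>
            (\<lambda>\<omega>. distr (K (\<omega> n)) (PiM {0..<Suc (Suc n)} (\<lambda>_. borel)) (fun_upd \<omega> (Suc n)))"
proof -
  interpret Ionescu_Tulcea "markov_step \<mu> K" "\<lambda>_. borel"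
    using assms by (rule Ionescu_Tulcea_markov_step)
  have law: "markov_law \<mu> K = PF.lim"
    by (simp add: markov_law_def)
  show s: "sets (markov_law \<mu> K) = sets (PiM UNIV (\<lambda>_. borel))"
    by (simp add: law)
  have ut: "up_to {0..<n} = n" for n
  proof (rule antisym)
    show "up_to {0..<n} \<le> n"
      by (simp add: up_to_iff_Ico)
    show "n \<le> up_to {0..<n}"
      using up_to[of "{0..<n}"] by (cases n) simp_all
  qed
  have C: "distr (markov_law \<mu> K) (PiM {0..<n} (\<lambda>_. borel)) (\<lambda>\<omega>. restrict \<omega> {0..<n})
      = C 0 n (\<lambda>_. undefined)" for n
    using distr_C[of n n "\<lambda>_. undefined" 0]
    by (simp add: law distr_lim CI_def ut)
  show prob: "prob_space (markov_law \<mu> K)"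
  proof (rule prob_space_distrD)
    show "(\<lambda>\<omega>. restrict \<omega> {0..<0}) \<in> markov_law \<mu> K \<rightarrow>\<^sub>M PiM {0..<0} (\<lambda>_. borel)"
      by (simp add: measurable_cong_sets[OF s refl])
    show "prob_space (distr (markov_law \<mu> K) (PiM {0..<0} (\<lambda>_. borel)) (\<lambda>\<omega>. restrict \<omega> {0..<0}))"
      unfolding C by (rule prob_space_C) simp
  qed
  show "distr (markov_law \<mu> K) (PiM {0..<Suc (Suc n)} (\<lambda>_. borel))
            (\<lambda>\<omega>. restrict \<omega> {0..<Suc (Suc n)}) =
          distr (markov_law \<mu> K) (PiM {0..<Suc n} (\<lambda>_. borel)) (\<lambda>\<omega>. restrict \<omega> {0..<Suc n}) \<bind>
            (\<lambda>\<omega>. distr (K (\<omega> n)) (PiM {0..<Suc (Suc n)} (\<lambda>_. borel)) (fun_upd \<omega> (Suc n)))"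
    unfolding C by (simp add: eP_def[abs_def] markov_step_def)
  show "distr (markov_law \<mu> K) borel (\<lambda>\<omega>. \<omega> 0) = \<mu>"
  proof -
    have "distr (markov_law \<mu> K) borel (\<lambda>\<omega>. \<omega> 0) =
        distr (distr (markov_law \<mu> K) (PiM {0..<Suc 0} (\<lambda>_. borel)) (\<lambda>\<omega>. restrict \<omega> {0..<Suc 0}))
          borel (\<lambda>\<omega>. \<omega> 0)"
      by (subst distr_distr) (auto simp: comp_def measurable_cong_sets[OF s refl]
          intro!: measurable_component_singleton)
    also have "\<dots> = distr (eP 0 (\<lambda>_. undefined)) borel (\<lambda>\<omega>. \<omega> 0)"
      unfolding C C.simps
      by (simp, subst bind_return[where N="PiM {0..<Suc 0} (\<lambda>_. borel)"])
        (use measurable_eP[of 0] in \<open>auto simp: space_PiM\<close>)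
    also have "\<dots> = distr \<mu> borel (\<lambda>s. s)"
      unfolding eP_def using measurable_fun_upd[of "{0..<Suc 0}" "{0..<0}" 0]
      by (subst distr_distr) (auto simp: comp_def markov_step_def measurable_cong_sets[OF mu(2) refl]
           intro!: measurable_component_singleton)
    also have "\<dots> = \<mu>"
      using mu(2) by (intro distr_id2) simp
    finally show ?thesis .
  qed
qed


section \<open>The process on the circle and the walk in the quasi-periodic environment\<close>

definition rotation_kernel :: "(circle \<Rightarrow> real) \<Rightarrow> real \<Rightarrow> circle \<Rightarrow> circle measure"
  where "rotation_kernel p \<alpha> y =
    distr (measure_pmf (bernoulli_pmf (p y))) borel
      (\<lambda>b. if b then y + to_circle \<alpha> else y - to_circle \<alpha>)"

definition walk_kernel :: "(circle \<Rightarrow> real) \<Rightarrow> real \<Rightarrow> circle \<Rightarrow> int \<Rightarrow> int measure"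
  where "walk_kernel p \<alpha> x k =
    distr (measure_pmf (bernoulli_pmf (p (x + to_circle (of_int k * \<alpha>))))) borel
      (\<lambda>b. if b then k + 1 else k - 1)"

lemma measurable_distr_bernoulli:
  fixes r :: "'s :: topological_space \<Rightarrow> real"
  assumes r: "r \<in> borel_measurable borel" "\<And>s. 0 \<le> r s" "\<And>s. r s \<le> 1"
    and f: "f \<in> borel \<rightarrow>\<^sub>M borel" and g: "g \<in> borel \<rightarrow>\<^sub>M borel"
  shows "(\<lambda>s. distr (measure_pmf (bernoulli_pmf (r s))) borel (\<lambda>b. if b then f s else g s))
    \<in> borel \<rightarrow>\<^sub>M subprob_algebra (borel :: 's measure)"
proof (rule measurable_subprob_algebra)
  fix A :: "'s set" assume A: "A \<in> sets borel"
  have "emeasure (distr (measure_pmf (bernoulli_pmf (r s))) borel (\<lambda>b. if b then f s else g s)) A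
      = ennreal (r s) * indicator A (f s) + ennreal (1 - r s) * indicator A (g s)" for s
  proof -
    have "emeasure (distr (measure_pmf (bernoulli_pmf (r s))) borel (\<lambda>b. if b then f s else g s)) A
      = (\<integral>\<^sup>+b. indicator A (if b then f s else g s) \<partial>measure_pmf (bernoulli_pmf (r s)))"
      using A by (subst nn_integral_indicator[symmetric], simp, subst nn_integral_distr) simp_all
    then show ?thesis
      using r(2,3) by (simp add: nn_integral_bernoulli_pmf mult.commute)
  qed
  moreover have "(\<lambda>s. ennreal (r s) * indicator A (f s) + ennreal (1 - r s) * indicator A (g s))
      \<in> borel_measurable borel"
    using A r(1) f g by measurable
  ultimately show "(\<lambda>s. emeasure (distr (measure_pmf (bernoulli_pmf (r s))) borel
      (\<lambda>b. if b then f s else g s)) A) \<in> borel_measurable borel"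
    by simp
qed (auto intro!: prob_space_imp_subprob_space prob_space.prob_space_distr prob_space_measure_pmf)

lemma measurable_rotation_kernel:
  assumes "continuous_on UNIV p" "\<And>y. 0 \<le> p y" "\<And>y. p y \<le> 1"
  shows "rotation_kernel p \<alpha> \<in> borel \<rightarrow>\<^sub>M subprob_algebra borel"
  using assms continuous_on_circle_add[of "to_circle \<alpha>"] continuous_on_circle_add[of "- to_circle \<alpha>"]
  unfolding rotation_kernel_def[abs_def]
  by (intro measurable_distr_bernoulli) (auto intro!: borel_measurable_continuous_onI)

lemma measurable_walk_kernel:
  assumes "\<And>y. 0 \<le> p y" "\<And>y. p y \<le> 1"
  shows "walk_kernel p \<alpha> x \<in> borel \<rightarrow>\<^sub>M subprob_algebra borel"
  using assms unfolding walk_kernel_def[abs_def]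
  by (intro measurable_distr_bernoulli) (auto intro!: borel_measurable_continuous_onI)

definition circle_law :: "(circle \<Rightarrow> real) \<Rightarrow> real \<Rightarrow> circle measure \<Rightarrow> (nat \<Rightarrow> circle) measure"
  where "circle_law p \<alpha> \<mu> = markov_law \<mu> (rotation_kernel p \<alpha>)"

definition walk_law :: "(circle \<Rightarrow> real) \<Rightarrow> real \<Rightarrow> circle \<Rightarrow> (nat \<Rightarrow> int) measure"
  where "walk_law p \<alpha> x = markov_law (return borel 0) (walk_kernel p \<alpha> x)"

definition stationary :: "(circle \<Rightarrow> real) \<Rightarrow> real \<Rightarrow> circle measure \<Rightarrow> bool"
  where "stationary p \<alpha> \<mu> \<longleftrightarrow> prob_space \<mu> \<and> sets \<mu> = sets borel \<and>
    (\<forall>\<phi> :: circle \<Rightarrow> real. continuous_on UNIV \<phi> \<longrightarrow>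
      (\<forall>n. (\<integral>X. \<phi> (X n) \<partial>circle_law p \<alpha> \<mu>) = (\<integral>X. \<phi> (X 0) \<partial>circle_law p \<alpha> \<mu>)))"

text \<open>The value is \<open>\<infinity>\<close> on paths that never visit \<open>k\<close>.\<close>

definition ladder_time :: "int \<Rightarrow> (nat \<Rightarrow> int) \<Rightarrow> enat"
  where "ladder_time k \<xi> = (INF j \<in> {j. \<xi> j = k}. enat j)"

end

theory Submission
  imports Defs
begin

text \<open>
  Write \<open>P\<close> for the transition operator of \<open>(X\<^sub>n)\<close>, so that
  \<open>\<bbbE>\<^sub>x \<phi>(X\<^sub>n) = P\<^sup>n \<phi>(x)\<close>. Two facts about the two-step operator \<open>L = P\<^sup>2\<close> give the theorem.

  \<^item> \<^emph>\<open>The chain forgets time.\<close> After two steps the walk is back where it was with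
  probability bounded below, so \<open>L\<close> is a lazy averaging operator. For such an operator
  \<open>L\<^sup>n\<^sup>+\<^sup>1 \<phi> - L\<^sup>n \<phi>\<close> tends to \<open>0\<close> (\<open>lazy_operator_increments\<close>). Hence every weak limit
  point of the laws of \<open>X\<^sub>2\<^sub>n\<close> under \<open>\<bbbP>\<^sub>x\<close> is an \<open>L\<close>-stationary measure (\<open>two_step_limit\<close>).

  \<^item> \<^emph>\<open>There is only one \<open>L\<close>-stationary measure\<close> (\<open>invariant_unique\<close>). By compactness the laws of
  \<open>X\<^sub>2\<^sub>n\<close> therefore converge to it. Its image under \<open>P\<close> is \<open>L\<close>-stationary as well, hence
  equal to it, which takes care of the odd times and of \<open>P\<close>-stationarity.

  For the uniqueness, regard \<open>L\<close> as a nearest neighbour walk along the rotation by \<open>\<beta> = 2\<alpha>\<close>, with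
  rates \<open>a(y)\<close> to the right and \<open>b(y)\<close> to the left; \<open>V = log (a/b)\<close> again has bounded variation
  and mean zero. Let \<open>\<nu>\<close> be stationary. Its net flux \<open>\<phi> \<mapsto> \<integral> a(y) \<phi>(y+\<beta>) - b(y) \<phi>(y) d\<nu>\<close> through a
  bond is invariant under the rotation, thus a multiple \<open>\<kappa>\<close> of Lebesgue measure. If \<open>\<kappa>\<close> were not
  zero, the integrals of \<open>exp (V(y) + \<dots> + V(y+(n-1)\<beta>))\<close> against \<open>b \<nu>\<close> would grow or decrease at
  least linearly in \<open>n\<close>, whereas by the Denjoy-Koksma inequality they stay between zero and a
  constant along the denominators \<open>n\<close> of good rational approximations of \<open>\<beta>\<close>. So \<open>\<kappa> = 0\<close>
  (\<open>no_flux\<close>), which says that \<open>\<rho> = b \<nu>\<close> is conformal: \<open>\<integral> \<phi> d\<rho> = \<integral> exp V(y) \<phi>(y+\<beta>) d\<rho>\<close>.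

  Conformal probability measures are unique. Iterating the conformal relation over \<open>n\<close> steps writes
  \<open>\<integral> \<phi> d\<rho>\<close> through weighted orbit sums of \<open>\<phi>\<close>. For a good denominator \<open>n\<close> the orbit
  segments of any two points shadow each other after a cyclic relabelling, and bounded variation
  bounds the distortion of the weights by a universal constant (\<open>orbit_sums_comparable\<close>). So any two
  conformal means are comparable up to a universal constant \<open>C\<close>, and a contraction argument improves
  \<open>C\<close> to \<open>1\<close>: if \<open>\<Lambda> \<ge> t \<Lambda>'\<close> with \<open>t < 1\<close>, the normalised difference is again conformal, so it
  dominates \<open>\<Lambda>'/C\<close>, and \<open>t\<close> may be increased by \<open>(1-t)/C\<close>.
\<close>

section \<open>Continuous functions and Borel measures on the circle\<close>

lemma to_circle_eq_iff: "to_circle s = to_circle t \<longleftrightarrow> s - t \<in> \<int>"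
  using circle.abs_eq_iff by blast

lemma to_circle_of_int [simp]: "to_circle (of_int m) = 0"
  unfolding zero_circle_def by (simp add: to_circle_eq_iff)

lemma to_circle_0 [simp]: "to_circle 0 = 0"
  by (simp add: zero_circle_def)

lemma to_circle_add_of_int [simp]: "to_circle (t + of_int m) = to_circle t"
  by (simp add: to_circle_eq_iff)

lemma to_circle_minus: "to_circle (- a) = - to_circle a"
  by transfer simp

lemma to_circle_frac [simp]: "to_circle (frac t) = to_circle t"
  by (simp add: to_circle_eq_iff frac_def)

lemma circle_unit_rep:
  obtains t where "0 \<le> t" "t < 1" "y = to_circle t"
proof -
  obtain r where "y = to_circle r"
    using to_circle_surj by blast
  then show thesis
    by (intro that[of "frac r"]) (auto simp: frac_lt_1)
qed

lemma continuous_circle_iff: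
  fixes \<phi> :: "circle \<Rightarrow> 'a :: topological_space"
  shows "continuous_on UNIV \<phi> \<longleftrightarrow> continuous_on UNIV (\<lambda>t. \<phi> (to_circle t))"
  by (simp add: continuous_on_open_vimage open_circle_def vimage_def)

lemma continuous_circle_shift:
  assumes "continuous_on UNIV (\<phi> :: circle \<Rightarrow> 'a :: topological_space)"
  shows "continuous_on UNIV (\<lambda>y. \<phi> (y + c))"
  by (rule continuous_on_compose2[OF assms continuous_on_circle_add]) auto

lemma range_circle: "range \<phi> = (\<lambda>t. \<phi> (to_circle t)) ` {0..1}"
proof -
  have "\<phi> y \<in> (\<lambda>t. \<phi> (to_circle t)) ` {0..1}" for y
    by (rule circle_unit_rep[of y]) auto
  then show ?thesis
    by auto
qed

lemma continuous_circle_bounded: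
  fixes \<phi> :: "circle \<Rightarrow> real"
  assumes "continuous_on UNIV \<phi>"
  obtains M where "0 < M" "\<And>y. \<bar>\<phi> y\<bar> \<le> M"
proof -
  have "continuous_on {0..1} (\<lambda>t. \<phi> (to_circle t))"
    using assms continuous_on_subset unfolding continuous_circle_iff by blast
  then have "compact (range \<phi>)"
    unfolding range_circle[of \<phi>] by (intro compact_continuous_image) auto
  then obtain M where "\<forall>y\<in>range \<phi>. norm y \<le> M"
    using compact_imp_bounded bounded_iff by metis
  then show thesis
    by (intro that[of "max 1 M"]) (auto simp: max_def intro: order_trans)
qed

lemma continuous_circle_positive:
  fixes \<phi> :: "circle \<Rightarrow> real"
  assumes "continuous_on UNIV \<phi>" "\<And>y. 0 < \<phi> y"
  obtains m where "0 < m" "\<And>y. m \<le> \<phi> y"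
proof -
  have "continuous_on {0..1} (\<lambda>t. \<phi> (to_circle t))"
    using assms(1) continuous_on_subset unfolding continuous_circle_iff by blast
  then have "compact (range \<phi>)"
    unfolding range_circle[of \<phi>] by (intro compact_continuous_image) auto
  then obtain s where "s \<in> range \<phi>" "\<forall>t\<in>range \<phi>. s \<le> t"
    using compact_attains_inf[of "range \<phi>"] by auto
  then show thesis
    using assms(2) by (intro that[of s]) auto
qed

lemma continuous_circle_uniform:
  fixes \<phi> :: "circle \<Rightarrow> real"
  assumes "continuous_on UNIV \<phi>" "0 < e"
  obtains d where "0 < d" "\<And>y s. \<bar>s\<bar> < d \<Longrightarrow> \<bar>\<phi> (y + to_circle s) - \<phi> y\<bar> < e"
proof -
  have "continuous_on {-1..2} (\<lambda>t. \<phi> (to_circle t))"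
    using assms(1) continuous_on_subset unfolding continuous_circle_iff by blast
  then have "uniformly_continuous_on {-1..2} (\<lambda>t. \<phi> (to_circle t))"
    by (intro compact_uniformly_continuous) auto
  then obtain d where d: "0 < d"
    "\<And>s t. s \<in> {-1..2} \<Longrightarrow> t \<in> {-1..2} \<Longrightarrow> dist s t < d
      \<Longrightarrow> dist (\<phi> (to_circle s)) (\<phi> (to_circle t)) < e"
    using assms(2) unfolding uniformly_continuous_on_def by metis
  show thesis
  proof (rule that[of "min d 1"])
    show "0 < min d 1"
      using d by simp
    fix y s assume s: "\<bar>s\<bar> < min d 1"
    obtain t where t: "0 \<le> t" "t < 1" "y = to_circle t"
      by (rule circle_unit_rep)
    show "\<bar>\<phi> (y + to_circle s) - \<phi> y\<bar> < e"
    proof -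
      have "-1 < s" "s < 1"
        using s by auto
      then show ?thesis
        using d(2)[of "t + s" t] s t unfolding t(3) by (simp add: dist_real_def to_circle_add)
    qed
  qed
qed

lemma continuous_circle_measurable:
  fixes \<phi> :: "circle \<Rightarrow> real"
  assumes "continuous_on UNIV \<phi>" "sets M = sets borel"
  shows "\<phi> \<in> borel_measurable M"
  using borel_measurable_continuous_onI[OF assms(1)] measurable_cong_sets[OF assms(2) refl] by blast

lemma continuous_circle_integrable:
  fixes \<phi> :: "circle \<Rightarrow> real"
  assumes "continuous_on UNIV \<phi>" "sets M = sets borel" "finite_measure M"
  shows "integrable M \<phi>"
proof -
  interpret finite_measure M by fact
  obtain B where "0 < B" "\<And>y. \<bar>\<phi> y\<bar> \<le> B"
    using continuous_circle_bounded[OF assms(1)] by blast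
  then show ?thesis
    by (intro integrable_const_bound[of _ B] continuous_circle_measurable assms) auto
qed

text \<open>The indicator of an open set is the increasing limit of continuous functions, built from the
  distance, on the universal cover, to the complement of that set.\<close>

lemma circle_measure_eqI:
  fixes \<mu> \<nu> :: "circle measure"
  assumes \<mu>: "prob_space \<mu>" "sets \<mu> = sets borel"
    and \<nu>: "prob_space \<nu>" "sets \<nu> = sets borel"
    and eq: "\<And>\<phi> :: circle \<Rightarrow> real. continuous_on UNIV \<phi> \<Longrightarrow> (\<integral>y. \<phi> y \<partial>\<mu>) = (\<integral>y. \<phi> y \<partial>\<nu>)"
  shows "\<mu> = \<nu>"
proof -
  interpret \<mu>: prob_space \<mu> by fact
  interpret \<nu>: prob_space \<nu> by fact
  have space: "space \<mu> = UNIV" "space \<nu> = UNIV"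
    using sets_eq_imp_space_eq[OF \<mu>(2)] sets_eq_imp_space_eq[OF \<nu>(2)] by auto
  have open_eq: "measure \<mu> U = measure \<nu> U" if U: "open U" for U
  proof (cases "U = UNIV")
    case True
    then show ?thesis
      using \<mu>.prob_space \<nu>.prob_space space by metis
  next
    case False
    define C where "C = - (to_circle -` U)"
    obtain y where "y \<notin> U"
      using False by blast
    moreover obtain r where "y = to_circle r"
      using to_circle_surj by blast
    ultimately have "r \<in> C"
      by (simp add: C_def)
    moreover have "closed C"
      using U by (simp add: C_def open_circle_def closed_Compl)
    ultimately have C: "closed C" "C \<noteq> {}"
      by auto
    have C_shift: "infdist s C = infdist t C" if "s - t \<in> \<int>" for s t
    proof -
      have le: "infdist s C \<le> infdist t C" if "s - t \<in> \<int>" for s t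
      proof -
        have "infdist s C \<le> dist t a" if "a \<in> C" for a
        proof -
          have "a + (s - t) \<in> C"
            using \<open>a \<in> C\<close> to_circle_eq_iff[of "a + (s - t)" a] \<open>s - t \<in> \<int>\<close>
            by (simp add: C_def)
          then have "infdist s C \<le> dist s (a + (s - t))"
            by (rule infdist_le)
          then show ?thesis
            by (simp add: dist_real_def)
        qed
        then show ?thesis
          using C(2) unfolding infdist_def by (auto intro: cINF_greatest)
      qed
      have "t - s \<in> \<int>"
        using that Ints_minus[of "s - t"] by simp
      then show ?thesis
        using le[OF that] le[of t s] by simp
    qed
    define f where "f n y = min 1 (real n * infdist (rep_circle y) C)" for n y
    have rep: "infdist (rep_circle (to_circle t)) C = infdist t C" for t
      using C_shift[of "rep_circle (to_circle t)" t] Quotient_abs_rep[OF Quotient_circle]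
      by (simp add: to_circle_eq_iff[symmetric])
    have cont: "continuous_on UNIV (f n)" for n
      unfolding continuous_circle_iff f_def rep by (intro continuous_intros)
    have lim: "(\<lambda>n. f n y) \<longlonglongrightarrow> indicator U y" for y
    proof (cases "y \<in> U")
      case True
      have "rep_circle y \<notin> C"
        using True Quotient_abs_rep[OF Quotient_circle, of y] by (simp add: C_def)
      then have pos: "0 < infdist (rep_circle y) C"
        using infdist_pos_not_in_closed[OF C] by simp
      then obtain N where N: "1 < real N * infdist (rep_circle y) C"
        using reals_Archimedean3 by blast
      have "f n y = 1" if "N \<le> n" for n
      proof -
        have "real N * infdist (rep_circle y) C \<le> real n * infdist (rep_circle y) C"
          using that pos by (intro mult_right_mono) auto
        then show ?thesis
          using N by (simp add: f_def)
      qed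
      then show ?thesis
        using True by (intro tendsto_eventually) (auto simp: eventually_sequentially)
    next
      case False
      have "rep_circle y \<in> C"
        using False Quotient_abs_rep[OF Quotient_circle, of y] by (simp add: C_def)
      then show ?thesis
        using False by (simp add: f_def)
    qed
    have bd: "\<bar>f n y\<bar> \<le> 1" for n y
      by (auto simp: f_def infdist_nonneg)
    have conv: "(\<lambda>n. \<integral>y. f n y \<partial>M) \<longlonglongrightarrow> (\<integral>y. indicator U y \<partial>M)"
      if "finite_measure M" "sets M = sets borel" for M
    proof (rule integral_dominated_convergence[where w = "\<lambda>_. 1"])
      show "indicator U \<in> borel_measurable M"
        using U that(2) by (intro borel_measurable_indicator) auto
    qed (use that cont bd lim in
        \<open>auto intro: continuous_circle_measurable finite_measure.integrable_const\<close>)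
    have lims: "(\<lambda>n. \<integral>y. f n y \<partial>\<mu>) \<longlonglongrightarrow> measure \<mu> U" "(\<lambda>n. \<integral>y. f n y \<partial>\<nu>) \<longlonglongrightarrow> measure \<nu> U"
      using conv[OF \<mu>.finite_measure_axioms \<mu>(2)] conv[OF \<nu>.finite_measure_axioms \<nu>(2)]
      by (simp_all add: space)
    show ?thesis
      using LIMSEQ_unique[OF lims(1)] lims(2) eq[OF cont] by simp
  qed
  show ?thesis
  proof (rule measure_eqI_generator_eq[where E = "{U. open U}" and \<Omega> = UNIV and A = "\<lambda>_. UNIV"])
    show "Int_stable {U :: circle set. open U}"
      by (auto simp: Int_stable_def)
    show "sets \<mu> = sigma_sets UNIV {U. open U}" "sets \<nu> = sigma_sets UNIV {U. open U}"
      using \<mu> \<nu> by (auto simp: borel_def)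
  qed (use open_eq \<mu>.emeasure_finite in \<open>auto simp: \<mu>.emeasure_eq_measure \<nu>.emeasure_eq_measure\<close>)
qed

lemma integral_translate:
  fixes f :: "real \<Rightarrow> real"
  assumes "continuous_on UNIV f"
  shows "integral {a..b} (\<lambda>t. f (t + r)) = integral {a + r..b + r} f"
proof -
  have "f integrable_on {a + r..b + r}"
    using assms continuous_on_subset by (intro integrable_continuous_real) blast
  then have "(f has_integral integral {a + r..b + r} f) (cbox (a + r) (b + r))"
    by (simp add: integrable_integral)
  from has_integral_affinity'[OF this, of 1 r] show ?thesis
    by (simp add: integral_unique)
qed

text \<open>The pieces \<open>[a, s]\<close> and \<open>[a + 1, s + 1]\<close> in which two windows of length one differ carry
  the same integral.\<close>

lemma integral_period_shift:
  fixes f :: "real \<Rightarrow> real"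
  assumes f: "continuous_on UNIV f" and per: "\<And>t. f (t + 1) = f t"
  shows "integral {s..s + 1} f = integral {0..1} f"
proof -
  have int: "f integrable_on {a..b}" for a b
    using f continuous_on_subset by (intro integrable_continuous_real) blast
  have const: "integral {s..s + 1} f = integral {a..a + 1} f" if "a \<le> s" for a s
  proof -
    have "integral {a..s} f = integral {a + 1..s + 1} f"
      using integral_translate[OF f, of a s 1] by (simp add: per)
    moreover have "integral {a..s} f + integral {s..s + 1} f = integral {a..s + 1} f"
      "integral {a..a + 1} f + integral {a + 1..s + 1} f = integral {a..s + 1} f"
      using that int by (auto intro!: Henstock_Kurzweil_Integration.integral_combine)
    ultimately show ?thesis
      by simp
  qed
  show ?thesis
    using const[of 0 s] const[of s 0] by (cases "0 \<le> s") auto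
qed

lemma circle_lebesgue_properties:
  shows sets_circle_lebesgue: "sets circle_lebesgue = sets borel"
    and prob_space_circle_lebesgue: "prob_space circle_lebesgue"
proof -
  show "sets circle_lebesgue = sets borel"
    by (simp add: circle_lebesgue_def)
  have "to_circle \<in> restrict_space lborel {0..<1} \<rightarrow>\<^sub>M borel"
    using borel_measurable_continuous_onI[OF continuous_on_to_circle]
    by (intro measurable_restrict_space1) auto
  moreover have "prob_space (restrict_space lborel {0..<1 :: real})"
    by (rule prob_spaceI) (simp add: emeasure_restrict_space space_restrict_space)
  ultimately show "prob_space circle_lebesgue"
    unfolding circle_lebesgue_def by (rule prob_space.prob_space_distr[rotated])
qed

lemma circle_lebesgue_integral:
  fixes \<phi> :: "circle \<Rightarrow> real"
  assumes \<phi>: "continuous_on UNIV \<phi>"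
  shows "(\<integral>y. \<phi> y \<partial>circle_lebesgue) = integral {0..1} (\<lambda>t. \<phi> (to_circle t))"
proof -
  have tc: "to_circle \<in> restrict_space lborel {0..<1} \<rightarrow>\<^sub>M borel"
    using borel_measurable_continuous_onI[OF continuous_on_to_circle]
    by (intro measurable_restrict_space1) auto
  have cont: "continuous_on {0..1} (\<lambda>t. \<phi> (to_circle t))"
    using assms continuous_on_subset unfolding continuous_circle_iff by blast
  have si: "set_integrable lborel {0..1} (\<lambda>t. \<phi> (to_circle t))"
    by (rule borel_integrable_atLeastAtMost'[OF cont])
  have "(\<integral>y. \<phi> y \<partial>circle_lebesgue) = (\<integral>t. \<phi> (to_circle t) \<partial>restrict_space lborel {0..<1})"
    unfolding circle_lebesgue_def by (intro integral_distr tc borel_measurable_continuous_onI \<phi>)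
  also have "\<dots> = (LINT t:{0..<1}|lborel. \<phi> (to_circle t))"
    by (subst integral_restrict_space) (auto simp: set_lebesgue_integral_def)
  also have "\<dots> = (LINT t:{0..1}|lborel. \<phi> (to_circle t))"
    using AE_lborel_singleton[of 1] unfolding set_lebesgue_integral_def
    using borel_measurable_continuous_onI[OF \<phi>[unfolded continuous_circle_iff]]
    by (intro integral_cong_AE) (auto elim!: eventually_mono split: split_indicator)
  also have "\<dots> = integral {0..1} (\<lambda>t. \<phi> (to_circle t))"
    using si by (rule set_borel_integral_eq_integral(2))
  finally show ?thesis .
qed

lemma circle_lebesgue_shift:
  fixes \<phi> :: "circle \<Rightarrow> real"
  assumes \<phi>: "continuous_on UNIV \<phi>"
  shows "(\<integral>y. \<phi> (y + c) \<partial>circle_lebesgue) = (\<integral>y. \<phi> y \<partial>circle_lebesgue)"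
proof -
  obtain r where r: "c = to_circle r"
    using to_circle_surj by blast
  define f where "f t = \<phi> (to_circle t)" for t
  have f: "continuous_on UNIV f"
    using \<phi> unfolding continuous_circle_iff f_def .
  have per: "f (t + 1) = f t" for t
    using to_circle_add_of_int[of t 1] by (simp add: f_def)
  have "(\<integral>y. \<phi> (y + c) \<partial>circle_lebesgue) = integral {0..1} (\<lambda>t. f (t + r))"
    using circle_lebesgue_integral[OF continuous_circle_shift[OF \<phi>]]
    by (simp add: f_def r to_circle_add)
  also have "\<dots> = integral {r..r + 1} f"
    using integral_translate[OF f, of 0 1 r] by (simp add: add.commute)
  also have "\<dots> = integral {0..1} f"
    using integral_period_shift[of f r, OF f per] .
  finally show ?thesis
    unfolding circle_lebesgue_integral[OF \<phi>] by (simp add: f_def[abs_def])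
qed


section \<open>Functions of bounded variation\<close>

text \<open>A stand-in for the total variation of \<open>f\<close> up to \<open>t\<close> on the universal cover. Any
  nondecreasing \<open>T\<close> whose increments dominate those of \<open>f\<close> serves; such functions add up and translate,
  and sums of increments of \<open>f\<close> over overlapping arcs turn into telescoping sums of \<open>T\<close>.\<close>

definition variation_majorant :: "(real \<Rightarrow> real) \<Rightarrow> real \<Rightarrow> (circle \<Rightarrow> real) \<Rightarrow> bool"
  where "variation_majorant T W f \<longleftrightarrow> (\<forall>t. T (t + 1) = T t + W) \<and>
    (\<forall>s t. s \<le> t \<longrightarrow> \<bar>f (to_circle t) - f (to_circle s)\<bar> \<le> T t - T s)"

lemma variation_majorantD:
  assumes "variation_majorant T W f"
  shows variation_majorant_period: "T (t + 1) = T t + W"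
    and variation_majorant_bound: "s \<le> t \<Longrightarrow> \<bar>f (to_circle t) - f (to_circle s)\<bar> \<le> T t - T s"
    and variation_majorant_mono: "s \<le> t \<Longrightarrow> T s \<le> T t"
    and variation_majorant_nonneg: "0 \<le> W"
    and variation_majorant_of_int: "T (t + of_int m) = T t + of_int m * W"
proof -
  show per: "T (t + 1) = T t + W" for t
    using assms by (simp add: variation_majorant_def)
  show bound: "s \<le> t \<Longrightarrow> \<bar>f (to_circle t) - f (to_circle s)\<bar> \<le> T t - T s" for s t
    using assms by (simp add: variation_majorant_def)
  show mono: "s \<le> t \<Longrightarrow> T s \<le> T t" for s t
    using bound[of s t] by linarith
  show "0 \<le> W"
    using mono[of 0 1] per[of 0] by simp
  have nat: "T (t + of_nat k) = T t + of_nat k * W" for k t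
  proof (induction k)
    case (Suc k)
    then show ?case
      using per[of "t + of_nat k"] by (simp add: algebra_simps)
  qed simp
  show "T (t + of_int m) = T t + of_int m * W"
  proof (cases "0 \<le> m")
    case True
    then show ?thesis
      using nat[of t "nat m"] by simp
  next
    case False
    then show ?thesis
      using nat[of "t + of_int m" "nat (- m)"] by (simp add: algebra_simps)
  qed
qed

lemma variation_majorant_translate:
  assumes "variation_majorant T W f"
  shows "variation_majorant (\<lambda>t. T (t + r)) W (\<lambda>y. f (y + to_circle r))"
  using assms unfolding variation_majorant_def
  by (metis add.assoc add.commute add_right_mono to_circle_add)

lemma variation_majorant_add:
  assumes "variation_majorant T W f" "variation_majorant T' W' g"
  shows "variation_majorant (\<lambda>t. T t + T' t) (W + W') (\<lambda>y. f y + g y)"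
  unfolding variation_majorant_def
proof (intro conjI allI impI)
  show "T (t + 1) + T' (t + 1) = T t + T' t + (W + W')" for t
    using assms[THEN variation_majorant_period] by simp
  show "\<bar>f (to_circle t) + g (to_circle t) - (f (to_circle s) + g (to_circle s))\<bar>
      \<le> T t + T' t - (T s + T' s)" if "s \<le> t" for s t
    using assms[THEN variation_majorant_bound, OF that] by linarith
qed

lemma variation_majorant_contraction:
  assumes "variation_majorant T W f" "\<And>y z. \<bar>g y - g z\<bar> \<le> \<bar>f y - f z\<bar>"
  shows "variation_majorant T W g"
  using assms unfolding variation_majorant_def by (meson order_trans)

text \<open>On \<open>[0, 1]\<close> take for \<open>T\<close> the variation function: appending one point to a partition of
  \<open>[0, r]\<close> shows that its increments dominate. Extend it to the line by adding the full variation for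
  every completed turn.\<close>

lemma variation_majorant_exists:
  assumes "bounded_variation_circle f"
  obtains T W where "variation_majorant T W f"
proof -
  define v where "v t = f (to_circle t)" for t
  define A where "A r = {\<Sum>i<n. \<bar>v (t (Suc i)) - v (t i)\<bar> | n t. mono t \<and> t 0 = 0 \<and> t n = r}"
    for r :: real
  define F where "F r = Sup (A r)" for r
  obtain B where B: "\<And>n t. mono t \<Longrightarrow> t n \<le> t 0 + 1
      \<Longrightarrow> (\<Sum>i<n. \<bar>v (t (Suc i)) - v (t i)\<bar>) \<le> B"
    using assms unfolding bounded_variation_circle_def v_def by blast
  have bdd: "bdd_above (A r)" if "r \<le> 1" for r
    using B that by (intro bdd_aboveI[of _ B]) (auto simp: A_def)
  have ne: "A r \<noteq> {}" if "0 \<le> r" for r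
  proof -
    define t where "t i = (if i = 0 then 0 else r)" for i :: nat
    have "mono t" "t 0 = 0" "t 1 = r"
      using that by (auto simp: t_def mono_def)
    then have "(\<Sum>i<1. \<bar>v (t (Suc i)) - v (t i)\<bar>) \<in> A r"
      unfolding A_def by blast
    then show ?thesis
      by blast
  qed
  have nonneg: "0 \<le> F r" if r: "0 \<le> r" "r \<le> 1" for r
  proof -
    obtain s where s: "s \<in> A r"
      using ne[OF r(1)] by blast
    then have "0 \<le> s"
      by (auto simp: A_def intro: sum_nonneg)
    then show ?thesis
      unfolding F_def using cSup_upper[OF s bdd[OF r(2)]] by simp
  qed
  have step: "F r + \<bar>v r' - v r\<bar> \<le> F r'" if "0 \<le> r" "r \<le> r'" "r' \<le> 1" for r r'
  proof -
    have "s \<le> F r' - \<bar>v r' - v r\<bar>" if s: "s \<in> A r" for s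
    proof -
      obtain n t where t: "s = (\<Sum>i<n. \<bar>v (t (Suc i)) - v (t i)\<bar>)" "mono t" "t 0 = 0" "t n = r"
        using s unfolding A_def by blast
      define t' where "t' i = (if i \<le> n then t i else r')" for i
      have "t i \<le> r'" if "i \<le> n" for i
        using monoD[OF t(2) that] t(4) \<open>r \<le> r'\<close> by simp
      then have "mono t'" "t' 0 = 0" "t' (Suc n) = r'"
        using t by (auto simp: t'_def mono_def)
      then have "(\<Sum>i<Suc n. \<bar>v (t' (Suc i)) - v (t' i)\<bar>) \<in> A r'"
        unfolding A_def by blast
      moreover have "(\<Sum>i<Suc n. \<bar>v (t' (Suc i)) - v (t' i)\<bar>) = s + \<bar>v r' - v r\<bar>"
        using t by (simp add: t'_def)
      ultimately show ?thesis
        unfolding F_def using cSup_upper[OF _ bdd[OF \<open>r' \<le> 1\<close>]] by fastforce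
    qed
    then have "F r \<le> F r' - \<bar>v r' - v r\<bar>"
      unfolding F_def[of r] using ne[OF that(1)] by (intro cSup_least) auto
    then show ?thesis
      by simp
  qed
  define T where "T t = of_int \<lfloor>t\<rfloor> * F 1 + F (frac t)" for t
  have v_frac: "v (frac t) = v t" for t
    by (simp add: v_def)
  have v_1: "v 1 = v 0"
    using to_circle_add_of_int[of 0 1] by (simp add: v_def)
  have "T (t + 1) = T t + F 1" for t
    by (simp add: T_def frac_def algebra_simps)
  moreover have "\<bar>v t - v s\<bar> \<le> T t - T s" if "s \<le> t" for s t
  proof (cases "\<lfloor>s\<rfloor> = \<lfloor>t\<rfloor>")
    case True
    then show ?thesis
      using step[of "frac s" "frac t"] that frac_lt_1[of t]
      by (simp add: T_def v_frac) (simp add: frac_def)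
  next
    case False
    then have "\<lfloor>s\<rfloor> + 1 \<le> \<lfloor>t\<rfloor>"
      using that floor_mono[of s t] by linarith
    then have "real_of_int (\<lfloor>s\<rfloor> + 1) \<le> real_of_int \<lfloor>t\<rfloor>"
      by (subst of_int_le_iff)
    then have "real_of_int (\<lfloor>s\<rfloor> + 1) * F 1 \<le> real_of_int \<lfloor>t\<rfloor> * F 1"
      using nonneg[of 1] by (intro mult_right_mono) auto
    moreover have "F (frac s) + \<bar>v 1 - v s\<bar> \<le> F 1" "F 0 + \<bar>v t - v 0\<bar> \<le> F (frac t)" "0 \<le> F 0"
      using step[of "frac s" 1] step[of 0 "frac t"] nonneg[of 0]
      by (auto simp: v_frac less_imp_le[OF frac_lt_1])
    ultimately show ?thesis
      unfolding T_def v_1 by (simp add: algebra_simps)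
  qed
  ultimately show thesis
    by (intro that[of T "F 1"]) (simp add: variation_majorant_def v_def)
qed


section \<open>Rational approximation and Birkhoff sums\<close>

text \<open>By Dirichlet's theorem an irrational \<open>\<beta>\<close> has infinitely many approximations of this quality. Since
  \<open>k \<beta>\<close> then stays within \<open>1/n\<close> of \<open>k a/n\<close> for all \<open>k \<le> n\<close>, the first \<open>n\<close> points of
  an orbit are distributed like the \<open>n\<close>-th roots of unity, up to one grid step.\<close>

definition dirichlet_fraction :: "real \<Rightarrow> int \<Rightarrow> nat \<Rightarrow> bool"
  where "dirichlet_fraction \<beta> a n \<longleftrightarrow>
    0 < n \<and> coprime a (int n) \<and> \<bar>\<beta> - of_int a / real n\<bar> < 1 / (real n)\<^sup>2"

text \<open>There are infinitely many good approximations, but only finitely many numerators belong to a bounded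
  set of denominators.\<close>

lemma dirichlet_fraction_large:
  assumes "\<beta> \<notin> \<rat>"
  obtains a n where "dirichlet_fraction \<beta> a n" "N < n"
proof -
  have "\<exists>a n. dirichlet_fraction \<beta> a n \<and> N < n"
  proof (rule ccontr)
    assume none: "\<not> ?thesis"
    define C where "C = \<lceil>real N * (\<bar>\<beta>\<bar> + 1)\<rceil>"
    have "approx_set \<beta> \<subseteq> {-C..C} \<times> {0..int N}"
    proof safe
      fix h k assume "(h, k) \<in> approx_set \<beta>"
      then have hk: "0 < k" "coprime h k" "\<bar>\<beta> - of_int h / of_int k\<bar> < 1 / (of_int k)\<^sup>2"
        by (auto simp: approx_set_def)
      have "dirichlet_fraction \<beta> h (nat k)"
        using hk by (simp add: dirichlet_fraction_def)
      then have "nat k \<le> N"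
        using none by (meson linorder_not_le)
      then show k: "k \<in> {0..int N}"
        using hk(1) by auto
      have "1 / (real_of_int k)\<^sup>2 \<le> 1"
        using hk(1) by (simp add: self_le_power)
      then have "\<bar>of_int h / of_int k\<bar> \<le> \<bar>\<beta>\<bar> + 1"
        using hk(3) by linarith
      then have "\<bar>real_of_int h\<bar> \<le> (\<bar>\<beta>\<bar> + 1) * real_of_int k"
        using hk(1) by (simp add: abs_divide divide_le_eq)
      also have "\<dots> \<le> (\<bar>\<beta>\<bar> + 1) * real N"
        using k of_int_le_iff[of k "int N", where 'a = real] by (intro mult_left_mono) auto
      finally have "\<bar>h\<bar> \<le> C"
        unfolding C_def by (simp add: le_ceiling_iff mult.commute)
      then show "h \<in> {-C..C}"
        by auto
    qed
    then have "finite (approx_set \<beta>)"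
      by (rule finite_subset) auto
    then show False
      using assms rational_iff_finite_approx_set by blast
  qed
  then show thesis
    using that by blast
qed

lemma dirichlet_fraction_multiple:
  assumes "dirichlet_fraction \<beta> a n" "k \<le> n"
  shows "\<bar>real k * \<beta> - real k * of_int a / real n\<bar> \<le> 1 / real n"
proof -
  have n: "0 < real n"
    using assms by (simp add: dirichlet_fraction_def)
  have "real k * \<beta> - real k * of_int a / real n = real k * (\<beta> - of_int a / real n)"
    by (simp add: right_diff_distrib)
  then have "\<bar>real k * \<beta> - real k * of_int a / real n\<bar> = real k * \<bar>\<beta> - of_int a / real n\<bar>"
    by (simp only: abs_mult abs_of_nat)
  also have "\<dots> \<le> real n * (1 / (real n)\<^sup>2)"
    using assms by (intro mult_mono) (auto simp: dirichlet_fraction_def)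
  also have "\<dots> = 1 / real n"
    using n by (simp add: power2_eq_square)
  finally show ?thesis .
qed

text \<open>The windows of half-width \<open>3/n\<close> around \<open>z + k a/n\<close> are, modulo one, the windows around the grid
  points \<open>z + j/n\<close>, because \<open>k \<mapsto> k a\<close> permutes the residues modulo \<open>n\<close>. They cover
  the circle six times, so the increments of the majorant over them sum to six times its
  increment over a period.\<close>

lemma window_variation:
  assumes T: "variation_majorant T W f" and n: "0 < n" "coprime a (int n)"
    and s: "\<And>k. k < n \<Longrightarrow> \<bar>s k - (z + real k * of_int a / real n)\<bar> \<le> 3 / real n"
    and t: "\<And>k. k < n \<Longrightarrow> \<bar>t k - (z + real k * of_int a / real n)\<bar> \<le> 3 / real n"
  shows "(\<Sum>k<n. \<bar>f (to_circle (s k)) - f (to_circle (t k))\<bar>) \<le> 6 * W"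
proof -
  define D where "D u = T (u + 3 / real n) - T (u - 3 / real n)" for u
  have D_period: "D (u + of_int m) = D u" for u m
    using variation_majorant_of_int[OF T, of "u + 3 / real n" m]
      variation_majorant_of_int[OF T, of "u - 3 / real n" m]
    by (simp add: D_def algebra_simps)
  have bound: "\<bar>f (to_circle s) - f (to_circle t)\<bar> \<le> D u"
    if "\<bar>s - u\<bar> \<le> 3 / real n" "\<bar>t - u\<bar> \<le> 3 / real n" for s t u
  proof -
    have "T s \<le> T (u + 3 / real n)" "T (u - 3 / real n) \<le> T s"
      "T t \<le> T (u + 3 / real n)" "T (u - 3 / real n) \<le> T t"
      using that by (auto intro!: variation_majorant_mono[OF T])
    then show ?thesis
      using variation_majorant_bound[OF T, of s t] variation_majorant_bound[OF T, of t s]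
      unfolding D_def by linarith
  qed
  \<comment> \<open>The position of \<open>k a/n\<close> on the grid, which is a permutation of the indices.\<close>
  define r where "r k = nat ((int k * a) mod int n)" for k
  have r_lt: "r k < n" for k
    using n by (simp add: r_def nat_less_iff)
  have "inj_on r {..<n}"
  proof (rule inj_onI)
    fix k l assume kl: "k \<in> {..<n}" "l \<in> {..<n}" "r k = r l"
    then have "(int k * a) mod int n = (int l * a) mod int n"
      using n by (simp add: r_def eq_nat_nat_iff)
    then have "int n dvd (int k - int l) * a"
      by (simp add: mod_eq_dvd_iff left_diff_distrib)
    then have "int n dvd int k - int l"
      using n by (simp add: coprime_dvd_mult_left_iff coprime_commute)
    then show "k = l"
      using kl zdvd_imp_le[of "int n" "\<bar>int k - int l\<bar>"] by (cases "k = l") auto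
  qed
  then have bij: "bij_betw r {..<n} {..<n}"
    using r_lt by (simp add: bij_betw_def endo_inj_surj image_subset_iff)
  have D_r: "D (z + real k * of_int a / real n) = D (z + real (r k) / real n)" for k
  proof -
    have "int k * a = int (r k) + int n * ((int k * a) div int n)"
      using n by (simp add: r_def)
    then have "real_of_int (int k * a) = real_of_int (int (r k) + int n * ((int k * a) div int n))"
      by simp
    then have "real k * of_int a / real n = real (r k) / real n + of_int ((int k * a) div int n)"
      using n by (simp add: field_simps)
    then show ?thesis
      using D_period[of "z + real (r k) / real n" "(int k * a) div int n"] by (simp add: add.assoc)
  qed
  define H where "H j = T (z + (real j - 3) / real n)" for j
  have H_period: "H (j + n) = H j + W" for j
  proof -
    have "z + (real (j + n) - 3) / real n = (z + (real j - 3) / real n) + 1"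
      using n by (simp add: field_simps)
    then show ?thesis
      unfolding H_def using variation_majorant_period[OF T] by metis
  qed
  have telescope: "(\<Sum>j<n. H (j + m) - H j) = real m * W" for m
  proof (induction m)
    case (Suc m)
    have "(\<Sum>j<n. H (j + Suc m) - H j) = (\<Sum>j<n. H (Suc j + m) - H (j + m)) + (\<Sum>j<n. H (j + m) - H j)"
      by (simp add: sum.distrib[symmetric])
    also have "(\<Sum>j<n. H (Suc j + m) - H (j + m)) = W"
      using sum_lessThan_telescope[of "\<lambda>j. H (j + m)" n] H_period[of m] by (simp add: add.commute)
    finally show ?case
      using Suc by (simp add: algebra_simps)
  qed simp
  have "(\<Sum>k<n. \<bar>f (to_circle (s k)) - f (to_circle (t k))\<bar>)
      \<le> (\<Sum>k<n. D (z + real k * of_int a / real n))"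
    using s t by (intro sum_mono bound) auto
  also have "\<dots> = (\<Sum>k<n. D (z + real (r k) / real n))"
    by (simp add: D_r)
  also have "\<dots> = (\<Sum>j<n. D (z + real j / real n))"
    by (rule sum.reindex_bij_betw[OF bij])
  also have "\<dots> = (\<Sum>j<n. H (j + 6) - H j)"
    by (simp add: D_def H_def add_divide_distrib diff_divide_distrib algebra_simps)
  also have "\<dots> = 6 * W"
    using telescope[of 6] by simp
  finally show ?thesis .
qed

definition birkhoff :: "real \<Rightarrow> (circle \<Rightarrow> real) \<Rightarrow> nat \<Rightarrow> circle \<Rightarrow> real"
  where "birkhoff \<beta> f n y = (\<Sum>k<n. f (y + to_circle (real k * \<beta>)))"

lemma birkhoff_0 [simp]: "birkhoff \<beta> f 0 y = 0"
  by (simp add: birkhoff_def)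

lemma birkhoff_add:
  "birkhoff \<beta> f (m + n) y = birkhoff \<beta> f m y + birkhoff \<beta> f n (y + to_circle (real m * \<beta>))"
proof (induction n)
  case (Suc n)
  then show ?case
    by (simp add: birkhoff_def algebra_simps to_circle_add)
qed simp

lemma birkhoff_Suc: "birkhoff \<beta> f (Suc n) y = f y + birkhoff \<beta> f n (y + to_circle \<beta>)"
  using birkhoff_add[of \<beta> f 1 n y] by (simp add: birkhoff_def)

lemma continuous_birkhoff:
  assumes "continuous_on UNIV f"
  shows "continuous_on UNIV (birkhoff \<beta> f n)"
  unfolding birkhoff_def[abs_def] by (intro continuous_on_sum continuous_circle_shift assms)

lemma birkhoff_lebesgue:
  assumes f: "continuous_on UNIV f"
  shows "(\<integral>y. birkhoff \<beta> f n y \<partial>circle_lebesgue) = real n * (\<integral>y. f y \<partial>circle_lebesgue)"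
proof -
  have "integrable circle_lebesgue (\<lambda>y. f (y + c))" for c
    by (intro continuous_circle_integrable continuous_circle_shift f sets_circle_lebesgue
        prob_space.finite_measure prob_space_circle_lebesgue)
  then show ?thesis
    by (simp add: birkhoff_def circle_lebesgue_shift[OF f])
qed

text \<open>Both points \<open>z + k \<beta>\<close> and \<open>z + \<theta> + k \<beta>\<close> lie within \<open>3/n\<close> of the grid point
  \<open>z + k a/n\<close>.\<close>

lemma birkhoff_variation:
  assumes T: "variation_majorant T W f" and cf: "dirichlet_fraction \<beta> a n"
    and "l \<le> n" "\<bar>\<theta>\<bar> \<le> 2 / real n"
  shows "\<bar>birkhoff \<beta> f l (z + to_circle \<theta>) - birkhoff \<beta> f l z\<bar> \<le> 6 * W"
proof -
  obtain z0 where z: "z = to_circle z0"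
    using to_circle_surj by blast
  have n: "0 < n" "coprime a (int n)"
    using cf by (auto simp: dirichlet_fraction_def)
  have near: "\<bar>real k * \<beta> - real k * of_int a / real n\<bar> \<le> 1 / real n" if "k < n" for k
    using dirichlet_fraction_multiple[OF cf, of k] that by simp
  have three: "3 / real n = 1 / real n + 2 / real n" "0 \<le> 2 / real n"
    by (simp_all add: add_divide_distrib[symmetric])
  have "\<bar>birkhoff \<beta> f l (z + to_circle \<theta>) - birkhoff \<beta> f l z\<bar>
      \<le> (\<Sum>k<l. \<bar>f (to_circle (z0 + \<theta> + real k * \<beta>)) - f (to_circle (z0 + real k * \<beta>))\<bar>)"
    unfolding birkhoff_def z by (simp add: sum_subtractf[symmetric] to_circle_add sum_abs)
  also have "\<dots> \<le> (\<Sum>k<n. \<bar>f (to_circle (z0 + \<theta> + real k * \<beta>)) - f (to_circle (z0 + real k * \<beta>))\<bar>)"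
    using assms by (intro sum_mono2) auto
  also have "\<dots> \<le> 6 * W"
  proof (rule window_variation[OF T n, where z = z0])
    fix k assume "k < n"
    have "\<bar>z0 + \<theta> + v - (z0 + u)\<bar> \<le> 3 / real n" "\<bar>z0 + v - (z0 + u)\<bar> \<le> 3 / real n"
      if "\<bar>v - u\<bar> \<le> 1 / real n" for u v
      using that assms(4) three by auto
    from this[OF near[OF \<open>k < n\<close>]]
    show "\<bar>z0 + \<theta> + real k * \<beta> - (z0 + real k * of_int a / real n)\<bar> \<le> 3 / real n"
      "\<bar>z0 + real k * \<beta> - (z0 + real k * of_int a / real n)\<bar> \<le> 3 / real n"
      by blast+
  qed
  finally show ?thesis .
qed

text \<open>Round \<open>y - x\<close> down to a grid point \<open>m/n\<close> and solve \<open>i a = m\<close> modulo \<open>n\<close>. Rounding and the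
  replacement of \<open>i a/n\<close> by \<open>i \<beta>\<close> each cost at most \<open>1/n\<close>.\<close>

lemma orbit_near:
  assumes cf: "dirichlet_fraction \<beta> a n"
  obtains i \<theta> where "i < n" "\<bar>\<theta>\<bar> \<le> 2 / real n" "y = x + to_circle (real i * \<beta>) + to_circle \<theta>"
proof -
  have n: "0 < n" "coprime a (int n)"
    using cf by (auto simp: dirichlet_fraction_def)
  obtain x0 y0 where xy: "x = to_circle x0" "y = to_circle y0"
    using to_circle_surj by blast
  define m where "m = \<lfloor>(y0 - x0) * real n\<rfloor>"
  obtain u w where uw: "u * a + w * int n = 1"
    using bezout_int[of a "int n"] n by (metis coprime_imp_gcd_eq_1)
  define i where "i = nat ((m * u) mod int n)"
  have i: "i < n" "int i = (m * u) mod int n"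
    using n by (auto simp: i_def nat_less_iff)
  define q where "q = (m * u) div int n"
  have "int i = m * u - int n * q"
    by (simp add: i q_def minus_mult_div_eq_mod)
  then have "int i * a = (m * u - int n * q) * a"
    by simp
  also have "\<dots> = m * (u * a) - int n * (q * a)"
    by (simp add: algebra_simps)
  also have "u * a = 1 - w * int n"
    using uw by simp
  also have "m * (1 - w * int n) - int n * (q * a) = m - int n * (m * w + q * a)"
    by (simp add: algebra_simps)
  finally have "int i * a = m - int n * (m * w + q * a)" .
  then have "real_of_int (int i * a) = real_of_int (m - int n * (m * w + q * a))"
    by simp
  then have ia: "real i * of_int a / real n = of_int m / real n - of_int (m * w + q * a)"
    using n by (simp add: field_simps)
  define \<theta> where "\<theta> = y0 - x0 - real i * \<beta> - of_int (m * w + q * a)"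
  have "\<theta> = (y0 - x0 - of_int m / real n) - (real i * \<beta> - real i * of_int a / real n)"
    by (simp add: \<theta>_def ia)
  moreover have "\<bar>real i * \<beta> - real i * of_int a / real n\<bar> \<le> 1 / real n"
    using dirichlet_fraction_multiple[OF cf, of i] i by simp
  moreover have "\<bar>y0 - x0 - of_int m / real n\<bar> \<le> 1 / real n"
  proof -
    have "\<bar>(y0 - x0) * real n - of_int m\<bar> \<le> 1"
      unfolding m_def by linarith
    moreover have "y0 - x0 - of_int m / real n = ((y0 - x0) * real n - of_int m) / real n"
      using n by (simp add: field_simps)
    ultimately show ?thesis
      using n by (simp add: abs_divide divide_right_mono)
  qed
  moreover have "2 / real n = 1 / real n + 1 / real n"
    by simp
  ultimately have "\<bar>\<theta>\<bar> \<le> 2 / real n"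
    by linarith
  moreover have "y = x + to_circle (real i * \<beta>) + to_circle \<theta>"
    unfolding xy to_circle_add[symmetric]
    using to_circle_eq_iff[of y0 "x0 + real i * \<beta> + \<theta>"] by (simp add: \<theta>_def)
  ultimately show thesis
    using that i by blast
qed

lemma dirichlet_fraction_return:
  assumes cf: "dirichlet_fraction \<beta> a n"
  obtains \<eta> where "\<bar>\<eta>\<bar> \<le> 1 / real n" "to_circle (real n * \<beta>) = to_circle \<eta>"
proof (rule that)
  have "real n * of_int a / real n = of_int a"
    using cf by (simp add: dirichlet_fraction_def)
  then show "\<bar>real n * \<beta> - of_int a\<bar> \<le> 1 / real n"
    using dirichlet_fraction_multiple[OF cf, of n] by simp
  show "to_circle (real n * \<beta>) = to_circle (real n * \<beta> - of_int a)"
    by (simp add: to_circle_eq_iff)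
qed

text \<open>To pass from \<open>x\<close> to \<open>y\<close>, move along the orbit of \<open>x\<close> to a point next to \<open>y\<close>, then across. The first
  move changes the sum of length \<open>n\<close> by a sum of length \<open>i < n\<close> between \<open>x\<close> and its \<open>n\<close>-th iterate,
  which is close to \<open>x\<close>. Each move costs at most \<open>B\<close>. Since the oscillation bound holds for all pairs
  of points, integrating over one of them compares the sum with its mean.\<close>

lemma birkhoff_deviation:
  assumes f: "continuous_on UNIV f" and cf: "dirichlet_fraction \<beta> a n"
    and B: "\<And>l \<theta> z. l \<le> n \<Longrightarrow> \<bar>\<theta>\<bar> \<le> 2 / real n
      \<Longrightarrow> \<bar>birkhoff \<beta> f l (z + to_circle \<theta>) - birkhoff \<beta> f l z\<bar> \<le> B"
  shows "\<bar>birkhoff \<beta> f n y - real n * (\<integral>y. f y \<partial>circle_lebesgue)\<bar> \<le> 2 * B"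
proof -
  have osc: "\<bar>birkhoff \<beta> f n y - birkhoff \<beta> f n x\<bar> \<le> 2 * B" for x y
  proof -
    obtain i \<theta> where i: "i < n" "\<bar>\<theta>\<bar> \<le> 2 / real n"
      "y = x + to_circle (real i * \<beta>) + to_circle \<theta>"
      using orbit_near[OF cf] by blast
    obtain \<eta> where \<eta>: "\<bar>\<eta>\<bar> \<le> 1 / real n" "to_circle (real n * \<beta>) = to_circle \<eta>"
      using dirichlet_fraction_return[OF cf] by blast
    have "\<bar>\<eta>\<bar> \<le> 2 / real n"
      using \<eta>(1) divide_right_mono[of 1 2 "real n"] by simp
    then have "\<bar>birkhoff \<beta> f i (x + to_circle (real n * \<beta>)) - birkhoff \<beta> f i x\<bar> \<le> B"
      unfolding \<eta>(2) using i by (intro B) auto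
    moreover have "birkhoff \<beta> f n x + birkhoff \<beta> f i (x + to_circle (real n * \<beta>))
        = birkhoff \<beta> f i x + birkhoff \<beta> f n (x + to_circle (real i * \<beta>))"
      using birkhoff_add[of \<beta> f n i x] birkhoff_add[of \<beta> f i n x] by (simp add: add.commute)
    moreover have "\<bar>birkhoff \<beta> f n y - birkhoff \<beta> f n (x + to_circle (real i * \<beta>))\<bar> \<le> B"
      unfolding i(3) using i by (intro B) auto
    ultimately show ?thesis
      by linarith
  qed
  interpret prob_space circle_lebesgue
    by (rule prob_space_circle_lebesgue)
  have int: "integrable circle_lebesgue (birkhoff \<beta> f n)"
    by (intro continuous_circle_integrable continuous_birkhoff f sets_circle_lebesgue finite_measure_axioms)
  have "(\<integral>x. birkhoff \<beta> f n y - 2 * B \<partial>circle_lebesgue) \<le> (\<integral>x. birkhoff \<beta> f n x \<partial>circle_lebesgue)"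
    using osc int by (intro integral_mono) (auto simp: abs_le_iff algebra_simps)
  moreover have "(\<integral>x. birkhoff \<beta> f n x \<partial>circle_lebesgue) \<le> (\<integral>x. birkhoff \<beta> f n y + 2 * B \<partial>circle_lebesgue)"
    using osc int by (intro integral_mono) (auto simp: abs_le_iff algebra_simps)
  ultimately show ?thesis
    unfolding birkhoff_lebesgue[OF f] by (simp add: prob_space abs_le_iff)
qed

text \<open>The Denjoy-Koksma inequality. The factor \<open>12\<close> comes from the two moves of \<open>birkhoff_deviation\<close>, each of
  which costs \<open>6 W\<close>.\<close>

lemma denjoy_koksma:
  assumes "continuous_on UNIV f" "variation_majorant T W f" "dirichlet_fraction \<beta> a n"
  shows "\<bar>birkhoff \<beta> f n y - real n * (\<integral>y. f y \<partial>circle_lebesgue)\<bar> \<le> 12 * W"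
  using birkhoff_deviation[OF assms(1,3) birkhoff_variation[OF assms(2,3)]] by simp

lemma birkhoff_average:
  assumes f: "continuous_on UNIV f" and \<beta>: "\<beta> \<notin> \<rat>" and e: "0 < e"
  obtains n where "0 < n" "\<And>y. \<bar>birkhoff \<beta> f n y / real n - (\<integral>y. f y \<partial>circle_lebesgue)\<bar> \<le> e"
proof -
  obtain d where d: "0 < d" "\<And>y s. \<bar>s\<bar> < d \<Longrightarrow> \<bar>f (y + to_circle s) - f y\<bar> < e / 2"
    using continuous_circle_uniform[OF f, of "e / 2"] e by auto
  obtain a n where cf: "dirichlet_fraction \<beta> a n" and n: "nat \<lceil>2 / d\<rceil> < n"
    using dirichlet_fraction_large[OF \<beta>] by blast
  have n0: "0 < n"
    using n by simp
  have "2 / d < real n"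
    using n by linarith
  then have "2 / real n < d"
    using d n0 by (simp add: field_simps)
  have "\<bar>birkhoff \<beta> f l (z + to_circle \<theta>) - birkhoff \<beta> f l z\<bar> \<le> real n * (e / 2)"
    if "l \<le> n" "\<bar>\<theta>\<bar> \<le> 2 / real n" for l \<theta> z
  proof -
    have "\<bar>birkhoff \<beta> f l (z + to_circle \<theta>) - birkhoff \<beta> f l z\<bar>
        \<le> (\<Sum>k<l. \<bar>f (z + to_circle (real k * \<beta>) + to_circle \<theta>) - f (z + to_circle (real k * \<beta>))\<bar>)"
      unfolding birkhoff_def by (simp add: sum_subtractf[symmetric] sum_abs ac_simps)
    also have "\<dots> \<le> (\<Sum>k<l. e / 2)"
      using that \<open>2 / real n < d\<close> by (intro sum_mono less_imp_le d(2)) auto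
    also have "\<dots> \<le> real n * (e / 2)"
      using that e by simp
    finally show ?thesis .
  qed
  from birkhoff_deviation[OF f cf this]
  have dev: "\<bar>birkhoff \<beta> f n y - real n * (\<integral>y. f y \<partial>circle_lebesgue)\<bar> \<le> real n * e" for y
    by simp
  have "\<bar>birkhoff \<beta> f n y / real n - (\<integral>y. f y \<partial>circle_lebesgue)\<bar> \<le> e" for y
  proof -
    have "birkhoff \<beta> f n y / real n - (\<integral>y. f y \<partial>circle_lebesgue)
        = (birkhoff \<beta> f n y - real n * (\<integral>y. f y \<partial>circle_lebesgue)) / real n"
      using n0 by (simp add: field_simps)
    then show ?thesis
      using dev[of y] n0 by (simp add: abs_divide divide_le_eq mult.commute)
  qed
  then show thesis
    using that n0 by blast
qed


section \<open>Conformal means\<close>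

text \<open>The uniqueness argument subtracts a multiple of one mean from another. For functionals on continuous
  functions the difference is again of the same kind as soon as it is positive.\<close>

definition positive_functional :: "((circle \<Rightarrow> real) \<Rightarrow> real) \<Rightarrow> bool"
  where "positive_functional \<Lambda> \<longleftrightarrow>
    (\<forall>f g. continuous_on UNIV f \<longrightarrow> continuous_on UNIV g \<longrightarrow> \<Lambda> (\<lambda>y. f y + g y) = \<Lambda> f + \<Lambda> g) \<and>
    (\<forall>c f. continuous_on UNIV f \<longrightarrow> \<Lambda> (\<lambda>y. c * f y) = c * \<Lambda> f) \<and>
    (\<forall>f. continuous_on UNIV f \<longrightarrow> (\<forall>y. 0 \<le> f y) \<longrightarrow> 0 \<le> \<Lambda> f)"

definition conformal_mean :: "real \<Rightarrow> (circle \<Rightarrow> real) \<Rightarrow> ((circle \<Rightarrow> real) \<Rightarrow> real) \<Rightarrow> bool"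
  where "conformal_mean \<beta> V \<Lambda> \<longleftrightarrow> positive_functional \<Lambda> \<and> \<Lambda> (\<lambda>_. 1) = 1 \<and>
    (\<forall>f. continuous_on UNIV f \<longrightarrow> \<Lambda> (\<lambda>y. exp (V y) * f (y + to_circle \<beta>)) = \<Lambda> f)"

lemma positive_functional_scale:
  assumes "positive_functional \<Lambda>" "continuous_on UNIV f"
  shows "\<Lambda> (\<lambda>y. c * f y) = c * \<Lambda> f"
  using assms by (simp add: positive_functional_def)

lemma
  assumes "positive_functional \<Lambda>" "continuous_on UNIV f" "continuous_on UNIV g"
  shows positive_functional_add: "\<Lambda> (\<lambda>y. f y + g y) = \<Lambda> f + \<Lambda> g"
    and positive_functional_mono: "(\<And>y. f y \<le> g y) \<Longrightarrow> \<Lambda> f \<le> \<Lambda> g"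
proof -
  show "\<Lambda> (\<lambda>y. f y + g y) = \<Lambda> f + \<Lambda> g"
    using assms by (simp add: positive_functional_def)
  assume "\<And>y. f y \<le> g y"
  moreover have cont: "continuous_on UNIV (\<lambda>y. g y - f y)"
    by (intro continuous_intros assms)
  ultimately have "0 \<le> \<Lambda> (\<lambda>y. g y - f y)"
    using assms(1) by (simp add: positive_functional_def)
  moreover have "\<Lambda> (\<lambda>y. f y + (g y - f y)) = \<Lambda> f + \<Lambda> (\<lambda>y. g y - f y)"
    using assms(1,2) cont unfolding positive_functional_def by blast
  ultimately show "\<Lambda> f \<le> \<Lambda> g"
    by simp
qed

lemma positive_functional_sum:
  fixes n :: nat
  assumes "positive_functional \<Lambda>" "\<And>j. continuous_on UNIV (f j)"
  shows "\<Lambda> (\<lambda>y. \<Sum>j<n. f j y) = (\<Sum>j<n. \<Lambda> (f j))"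
proof (induction n)
  case 0
  show ?case
    using positive_functional_scale[OF assms(1), of "\<lambda>_. 0" 0] by simp
next
  case (Suc n)
  then show ?case
    using positive_functional_add[OF assms(1), of "\<lambda>y. \<Sum>j<n. f j y" "f n"] assms(2)
    by (simp add: continuous_on_sum)
qed

lemma conformal_mean_transform:
  assumes "conformal_mean \<beta> V \<Lambda>" "continuous_on UNIV f"
  shows "\<Lambda> (\<lambda>y. exp (V y) * f (y + to_circle \<beta>)) = \<Lambda> f"
  using assms by (simp add: conformal_mean_def)

text \<open>The density that accumulates when the conformal relation is applied \<open>j\<close> times.\<close>

definition orbit_weight :: "real \<Rightarrow> (circle \<Rightarrow> real) \<Rightarrow> nat \<Rightarrow> circle \<Rightarrow> real"
  where "orbit_weight \<beta> V j y = exp (birkhoff \<beta> V j y)"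

definition orbit_sum :: "real \<Rightarrow> (circle \<Rightarrow> real) \<Rightarrow> nat \<Rightarrow> (circle \<Rightarrow> real) \<Rightarrow> circle \<Rightarrow> real"
  where "orbit_sum \<beta> V n f y = (\<Sum>j<n. orbit_weight \<beta> V j y * f (y + to_circle (real j * \<beta>)))"

lemma orbit_weight_pos: "0 < orbit_weight \<beta> V j y"
  by (simp add: orbit_weight_def)

lemma continuous_orbit_weight:
  "continuous_on UNIV V \<Longrightarrow> continuous_on UNIV (orbit_weight \<beta> V j)"
  unfolding orbit_weight_def[abs_def] by (intro continuous_on_exp continuous_birkhoff)

lemma continuous_orbit_sum:
  "continuous_on UNIV V \<Longrightarrow> continuous_on UNIV f \<Longrightarrow> continuous_on UNIV (orbit_sum \<beta> V n f)"
  unfolding orbit_sum_def[abs_def]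
  by (intro continuous_on_sum continuous_on_mult continuous_orbit_weight continuous_circle_shift)

lemma conformal_mean_orbit_sum:
  assumes \<Lambda>: "conformal_mean \<beta> V \<Lambda>" and V: "continuous_on UNIV V" and f: "continuous_on UNIV f"
  shows "\<Lambda> (orbit_sum \<beta> V n f) = real n * \<Lambda> f"
proof -
  have pos: "positive_functional \<Lambda>"
    using \<Lambda> by (simp add: conformal_mean_def)
  have cont: "continuous_on UNIV (\<lambda>y. orbit_weight \<beta> V j y * f (y + c))" for j c
    by (intro continuous_on_mult continuous_orbit_weight continuous_circle_shift V f)
  have "\<Lambda> (\<lambda>y. orbit_weight \<beta> V j y * f (y + to_circle (real j * \<beta>))) = \<Lambda> f" for j
  proof (induction j)
    case 0
    show ?case
      by (simp add: orbit_weight_def)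
  next
    case (Suc j)
    let ?h = "\<lambda>y. orbit_weight \<beta> V j y * f (y + to_circle (real j * \<beta>))"
    have "(\<lambda>y. orbit_weight \<beta> V (Suc j) y * f (y + to_circle (real (Suc j) * \<beta>)))
        = (\<lambda>y. exp (V y) * ?h (y + to_circle \<beta>))"
      by (simp add: orbit_weight_def birkhoff_Suc exp_add distrib_right to_circle_add add.assoc
          mult.assoc add.left_commute)
    then show ?case
      using conformal_mean_transform[OF \<Lambda> cont[of j "to_circle (real j * \<beta>)"]] Suc by simp
  qed
  then show ?thesis
    unfolding orbit_sum_def[abs_def] using positive_functional_sum[OF pos cont] by simp
qed

text \<open>Choose \<open>i < n\<close> such that the \<open>i\<close>-th iterate of \<open>x\<close> is next to \<open>y\<close>. Then the iterate number \<open>j\<close> of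
  \<open>x\<close> is next to the iterate number \<open>j - i\<close> (modulo \<open>n\<close>) of \<open>y\<close>, and, up to the common factor
  \<open>exp (S\<^sub>i(x))\<close>, the weights of the two agree within a factor \<open>exp (18 W)\<close>: the distortion
  between neighbouring orbits costs \<open>6 W\<close>, and a turn around \<open>n\<close> costs another \<open>12 W\<close> by
  Denjoy-Koksma. The statement compares the weighted averages \<open>A/N\<close> of \<open>f\<close> at \<open>x\<close> and \<open>y\<close>,
  so the common factor cancels.\<close>

lemma orbit_sums_comparable:
  assumes V: "continuous_on UNIV V" "variation_majorant T W V" "(\<integral>y. V y \<partial>circle_lebesgue) = 0"
    and cf: "dirichlet_fraction \<beta> a n" and f: "\<And>y. 0 \<le> f y"
    and e: "\<And>y s. \<bar>s\<bar> \<le> 3 / real n \<Longrightarrow> \<bar>f (y + to_circle s) - f y\<bar> \<le> e"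
  defines "N \<equiv> orbit_sum \<beta> V n (\<lambda>_. 1)" and "A \<equiv> orbit_sum \<beta> V n f"
  shows "A y * N x \<le> exp (36 * W) * (A x + e * N x) * N y"
proof -
  let ?S = "birkhoff \<beta> V" and ?E = "orbit_weight \<beta> V"
  have W: "0 \<le> W"
    using variation_majorant_nonneg[OF V(2)] .
  have e0: "0 \<le> e"
    using e[of 0 y] by simp
  obtain i \<theta> where i: "i < n" "\<bar>\<theta>\<bar> \<le> 2 / real n" "y = x + to_circle (real i * \<beta>) + to_circle \<theta>"
    using orbit_near[OF cf] by blast
  obtain \<eta> where \<eta>: "\<bar>\<eta>\<bar> \<le> 1 / real n" "to_circle (real n * \<beta>) = to_circle \<eta>"
    using dirichlet_fraction_return[OF cf] by blast
  have three: "3 / real n = 1 / real n + 2 / real n" "0 \<le> 1 / real n"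
    by (simp_all add: add_divide_distrib[symmetric])
  \<comment> \<open>The index of the point in the orbit of \<open>y\<close> that is next to the \<open>j\<close>-th iterate of \<open>x\<close>.\<close>
  define \<sigma> where "\<sigma> j = (if i \<le> j then j - i else j + n - i)" for j
  have \<sigma>: "bij_betw \<sigma> {..<n} {..<n}"
    by (rule bij_betwI[where g = "\<lambda>k. if k + i < n then k + i else k + i - n"])
      (use i(1) in \<open>auto simp: \<sigma>_def\<close>)
  have near: "\<bar>?S l y - ?S l (x + to_circle (real i * \<beta>))\<bar> \<le> 6 * W" if "l \<le> n" for l
    unfolding i(3) using birkhoff_variation[OF V(2) cf that i(2)] .
  have sums: "\<bar>?S j x - ?S i x - ?S (\<sigma> j) y\<bar> \<le> 18 * W" if "j < n" for j
  proof (cases "i \<le> j")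
    case True
    have "?S j x = ?S i x + ?S (\<sigma> j) (x + to_circle (real i * \<beta>))"
      using birkhoff_add[of \<beta> V i "j - i" x] True by (simp add: \<sigma>_def)
    moreover have "\<sigma> j \<le> n"
      using True that by (simp add: \<sigma>_def)
    ultimately show ?thesis
      using near[of "\<sigma> j"] W by linarith
  next
    case False
    then have "?S j x + ?S n (x + to_circle (real j * \<beta>))
        = ?S i x + ?S (\<sigma> j) (x + to_circle (real i * \<beta>))"
      using birkhoff_add[of \<beta> V i "j + n - i" x] birkhoff_add[of \<beta> V j n x] i(1)
      by (simp add: \<sigma>_def)
    moreover have "\<bar>?S n (x + to_circle (real j * \<beta>))\<bar> \<le> 12 * W"
      using denjoy_koksma[OF V(1,2) cf] V(3) by simp
    moreover have "\<sigma> j \<le> n"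
      using False i(1) by (simp add: \<sigma>_def)
    ultimately show ?thesis
      using near[of "\<sigma> j"] by linarith
  qed
  have points: "\<bar>f (y + to_circle (real (\<sigma> j) * \<beta>)) - f (x + to_circle (real j * \<beta>))\<bar> \<le> e" for j
  proof (cases "i \<le> j")
    case True
    then have "real i * \<beta> + \<theta> + real (\<sigma> j) * \<beta> = real j * \<beta> + \<theta>"
      by (simp add: \<sigma>_def of_nat_diff algebra_simps)
    then have "y + to_circle (real (\<sigma> j) * \<beta>) = x + to_circle (real j * \<beta>) + to_circle \<theta>"
      unfolding i(3) by (metis add.assoc to_circle_add)
    moreover have "\<bar>\<theta>\<bar> \<le> 3 / real n"
      using i(2) three by linarith
    ultimately show ?thesis
      using e by simp
  next
    case False
    then have "real i * \<beta> + \<theta> + real (\<sigma> j) * \<beta> = real j * \<beta> + (real n * \<beta> + \<theta>)"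
      using i(1) by (simp add: \<sigma>_def of_nat_diff algebra_simps)
    then have "y + to_circle (real (\<sigma> j) * \<beta>)
        = x + to_circle (real j * \<beta>) + to_circle (\<eta> + \<theta>)"
      unfolding i(3) to_circle_add[of \<eta>] \<eta>(2)[symmetric] by (metis add.assoc to_circle_add)
    moreover have "\<bar>\<eta> + \<theta>\<bar> \<le> 3 / real n"
      using i(2) \<eta>(1) three by linarith
    ultimately show ?thesis
      using e by simp
  qed
  define K where "K = exp (18 * W)"
  define s where "s = exp (?S i x)"
  have K: "0 < K" "K * K = exp (36 * W)" and s: "0 < s"
    by (simp_all add: K_def s_def mult_exp_exp)
  have upper: "s * ?E (\<sigma> j) y \<le> K * ?E j x" and lower: "?E j x \<le> K * s * ?E (\<sigma> j) y"
    if "j < n" for j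
    using sums[OF that] unfolding s_def K_def orbit_weight_def mult_exp_exp by auto
  have "s * A y = (\<Sum>j<n. s * ?E (\<sigma> j) y * f (y + to_circle (real (\<sigma> j) * \<beta>)))"
    unfolding A_def orbit_sum_def sum_distrib_left
    by (subst sum.reindex_bij_betw[OF \<sigma>, symmetric]) (simp add: mult.assoc)
  also have "\<dots> \<le> (\<Sum>j<n. K * ?E j x * (f (x + to_circle (real j * \<beta>)) + e))"
  proof (rule sum_mono)
    fix j assume "j \<in> {..<n}"
    then have j: "j < n"
      by simp
    show "s * ?E (\<sigma> j) y * f (y + to_circle (real (\<sigma> j) * \<beta>))
        \<le> K * ?E j x * (f (x + to_circle (real j * \<beta>)) + e)"
    proof (rule mult_mono[OF upper[OF j]])
      show "f (y + to_circle (real (\<sigma> j) * \<beta>)) \<le> f (x + to_circle (real j * \<beta>)) + e"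
        using points[of j] by linarith
      show "0 \<le> K * ?E j x"
        using K(1) orbit_weight_pos by (simp add: less_imp_le)
    qed (rule f)
  qed
  also have "\<dots> = K * (A x + e * N x)"
    unfolding A_def N_def orbit_sum_def sum_distrib_left sum.distrib[symmetric]
    by (intro sum.cong) (auto simp: algebra_simps)
  finally have A: "s * A y \<le> K * (A x + e * N x)" .
  have "N x \<le> (\<Sum>j<n. K * s * ?E (\<sigma> j) y)"
    unfolding N_def orbit_sum_def using lower by (intro sum_mono) simp
  also have "\<dots> = K * s * N y"
    unfolding N_def orbit_sum_def sum_distrib_left
    by (subst sum.reindex_bij_betw[OF \<sigma>, symmetric]) simp
  finally have N: "N x \<le> K * s * N y" .
  have nonneg: "0 \<le> A z" "0 \<le> N z" for z
    unfolding A_def N_def orbit_sum_def using f orbit_weight_pos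
    by (auto intro!: sum_nonneg mult_nonneg_nonneg simp: less_imp_le)
  have "(s * A y) * N x \<le> (K * (A x + e * N x)) * (K * s * N y)"
    using K(1) e0 by (intro mult_mono[OF A N] nonneg mult_nonneg_nonneg add_nonneg_nonneg) auto
  also have "\<dots> = s * ((K * K) * (A x + e * N x) * N y)"
    by (simp add: ac_simps)
  finally have "s * (A y * N x) \<le> s * ((K * K) * (A x + e * N x) * N y)"
    by (simp add: mult.assoc)
  then show ?thesis
    using s K(2) by simp
qed

text \<open>Integrate the comparison of orbit sums with \<open>\<Lambda>'\<close> in \<open>y\<close> and with \<open>\<Lambda>\<close> in \<open>x\<close>; the conformal
  relation evaluates both orbit sums exactly. The error \<open>e\<close> is the oscillation of \<open>f\<close> at scale
  \<open>3/n\<close> and disappears as \<open>n\<close> grows.\<close>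

lemma conformal_means_comparable:
  assumes \<beta>: "\<beta> \<notin> \<rat>"
    and V: "continuous_on UNIV V" "variation_majorant T W V" "(\<integral>y. V y \<partial>circle_lebesgue) = 0"
    and \<Lambda>: "conformal_mean \<beta> V \<Lambda>" and \<Lambda>': "conformal_mean \<beta> V \<Lambda>'"
    and f: "continuous_on UNIV f" "\<And>y. 0 \<le> f y"
  shows "\<Lambda>' f \<le> exp (36 * W) * \<Lambda> f"
proof -
  let ?C = "exp (36 * W)"
  have pos: "positive_functional \<Lambda>" "positive_functional \<Lambda>'"
    using \<Lambda> \<Lambda>' by (simp_all add: conformal_mean_def)
  have approx: "\<Lambda>' f \<le> ?C * (\<Lambda> f + e)" if "0 < e" for e
  proof -
    obtain d where d: "0 < d" "\<And>y s. \<bar>s\<bar> < d \<Longrightarrow> \<bar>f (y + to_circle s) - f y\<bar> < e"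
      using continuous_circle_uniform[OF f(1) \<open>0 < e\<close>] by blast
    obtain a n where cf: "dirichlet_fraction \<beta> a n" and n: "nat \<lceil>3 / d\<rceil> < n"
      using dirichlet_fraction_large[OF \<beta>] by blast
    have n0: "0 < n"
      using n by simp
    have "3 / d < real n"
      using n by linarith
    then have "3 / real n < d"
      using d n0 by (simp add: field_simps)
    then have e: "\<bar>f (y + to_circle s) - f y\<bar> \<le> e" if "\<bar>s\<bar> \<le> 3 / real n" for y s
      using d(2)[of s y] that by simp
    define N where "N = orbit_sum \<beta> V n (\<lambda>_. 1)"
    define A where "A = orbit_sum \<beta> V n f"
    have cont: "continuous_on UNIV N" "continuous_on UNIV A"
      unfolding N_def A_def by (auto intro: continuous_orbit_sum V f)
    have cmp: "A y * N x \<le> ?C * (A x + e * N x) * N y" for x y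
      using orbit_sums_comparable[where f = f and e = e and x = x and y = y, OF V cf f(2) e]
      unfolding A_def N_def .
    have means: "\<Lambda> N = real n" "\<Lambda>' N = real n" "\<Lambda> A = real n * \<Lambda> f" "\<Lambda>' A = real n * \<Lambda>' f"
      using \<Lambda> \<Lambda>' unfolding N_def A_def
      by (simp_all add: conformal_mean_orbit_sum V f) (simp_all add: conformal_mean_def)
    have "\<Lambda>' f * N x \<le> ?C * (A x + e * N x)" for x
    proof -
      have "\<Lambda>' (\<lambda>y. N x * A y) \<le> \<Lambda>' (\<lambda>y. (?C * (A x + e * N x)) * N y)"
      proof (rule positive_functional_mono[OF pos(2)])
        show "N x * A y \<le> (?C * (A x + e * N x)) * N y" for y
          using cmp[of y x] by (simp add: mult.commute)
      qed (intro continuous_intros cont)+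
      then have "N x * (real n * \<Lambda>' f) \<le> (?C * (A x + e * N x)) * real n"
        unfolding positive_functional_scale[OF pos(2) cont(1)]
          positive_functional_scale[OF pos(2) cont(2)] means .
      then have "real n * (\<Lambda>' f * N x) \<le> real n * (?C * (A x + e * N x))"
        by (simp add: ac_simps)
      then show ?thesis
        using n0 by simp
    qed
    then have "\<Lambda> (\<lambda>x. \<Lambda>' f * N x) \<le> \<Lambda> (\<lambda>x. ?C * (A x + e * N x))"
      by (rule positive_functional_mono[OF pos(1), rotated 2]) (intro continuous_intros cont)+
    also have "\<Lambda> (\<lambda>x. ?C * (A x + e * N x)) = ?C * (\<Lambda> A + e * \<Lambda> N)"
    proof -
      have eN: "continuous_on UNIV (\<lambda>x. e * N x)"
        by (intro continuous_intros cont)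
      then have "continuous_on UNIV (\<lambda>x. A x + e * N x)"
        by (intro continuous_intros cont)
      from positive_functional_scale[OF pos(1) this]
      show ?thesis
        by (simp add: positive_functional_add[OF pos(1) cont(2) eN]
            positive_functional_scale[OF pos(1) cont(1)])
    qed
    also have "\<Lambda> (\<lambda>x. \<Lambda>' f * N x) = \<Lambda>' f * \<Lambda> N"
      by (rule positive_functional_scale[OF pos(1) cont(1)])
    finally have "real n * \<Lambda>' f \<le> real n * (?C * (\<Lambda> f + e))"
      by (simp add: means algebra_simps)
    then show ?thesis
      using n0 by simp
  qed
  show ?thesis
  proof (rule field_le_epsilon)
    fix \<epsilon> :: real assume "0 < \<epsilon>"
    then show "\<Lambda>' f \<le> ?C * \<Lambda> f + \<epsilon>"
      using approx[of "\<epsilon> / ?C"] by (simp add: distrib_left)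
  qed
qed

text \<open>If \<open>\<Lambda>\<close> dominates \<open>(1 - r) \<Lambda>'\<close>, then \<open>(\<Lambda> - (1 - r) \<Lambda>') / r\<close> is again a conformal
  mean and so dominates \<open>\<Lambda>'/C\<close>. This replaces \<open>r\<close> by \<open>r (1 - 1/C)\<close>, and iteration drives \<open>r\<close> to
  zero.\<close>

lemma conformal_mean_le:
  assumes \<beta>: "\<beta> \<notin> \<rat>"
    and V: "continuous_on UNIV V" "variation_majorant T W V" "(\<integral>y. V y \<partial>circle_lebesgue) = 0"
    and \<Lambda>: "conformal_mean \<beta> V \<Lambda>" and \<Lambda>': "conformal_mean \<beta> V \<Lambda>'"
    and f: "continuous_on UNIV f" "\<And>y. 0 \<le> f y"
  shows "\<Lambda>' f \<le> \<Lambda> f"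
proof -
  define C where "C = exp (36 * W)"
  have C: "1 \<le> C"
    using variation_majorant_nonneg[OF V(2)] by (simp add: C_def)
  define \<rho> where "\<rho> = 1 - 1 / C"
  have \<rho>: "0 \<le> \<rho>" "\<rho> < 1"
    using C by (auto simp: \<rho>_def)
  have pos: "positive_functional \<Lambda>" "positive_functional \<Lambda>'"
    using \<Lambda> \<Lambda>' by (simp_all add: conformal_mean_def)
  have le: "\<forall>f. continuous_on UNIV f \<longrightarrow> (\<forall>y. 0 \<le> f y) \<longrightarrow> (1 - \<rho> ^ k) * \<Lambda>' f \<le> \<Lambda> f" for k
  proof (induction k)
    case 0
    show ?case
      using pos(1) by (simp add: positive_functional_def)
  next
    case (Suc k)
    show ?case
    proof (cases "\<rho> ^ k = 0")
      case True
      then have eq: "\<rho> ^ Suc k = \<rho> ^ k"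
        by simp
      show ?thesis
        unfolding eq by (rule Suc)
    next
      case False
      then have r: "0 < \<rho> ^ k"
        using zero_le_power[OF \<rho>(1), of k] by linarith
      define M where "M g = (\<Lambda> g - (1 - \<rho> ^ k) * \<Lambda>' g) / \<rho> ^ k" for g
      have "conformal_mean \<beta> V M"
        unfolding conformal_mean_def positive_functional_def
      proof (intro conjI allI impI)
        fix f g :: "circle \<Rightarrow> real" and c :: real
        assume f: "continuous_on UNIV f"
        show "M (\<lambda>y. c * f y) = c * M f"
          by (simp add: M_def positive_functional_scale[OF _ f] pos algebra_simps)
        show "M (\<lambda>y. exp (V y) * f (y + to_circle \<beta>)) = M f"
          by (simp add: M_def conformal_mean_transform[OF \<Lambda> f] conformal_mean_transform[OF \<Lambda>' f])
        show "0 \<le> M f" if "\<forall>y. 0 \<le> f y"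
          using Suc f that r by (simp add: M_def)
        show "M (\<lambda>y. f y + g y) = M f + M g" if g: "continuous_on UNIV g"
          by (simp add: M_def positive_functional_add[OF _ f g] pos algebra_simps
              add_divide_distrib diff_divide_distrib)
      next
        have "\<Lambda> (\<lambda>_. 1) = 1" "\<Lambda>' (\<lambda>_. 1) = 1"
          using \<Lambda> \<Lambda>' by (simp_all add: conformal_mean_def)
        then show "M (\<lambda>_. 1) = 1"
          using False by (simp add: M_def)
      qed
      then have "\<Lambda>' g \<le> C * M g" if "continuous_on UNIV g" "\<And>y. 0 \<le> g y" for g
        unfolding C_def by (intro conformal_means_comparable[OF \<beta> V _ \<Lambda>'] that)
      moreover have "(1 - \<rho> ^ Suc k) * b \<le> a"
        if "b \<le> C * ((a - (1 - \<rho> ^ k) * b) / \<rho> ^ k)" for a b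
      proof -
        have "b \<le> C * (a - (1 - \<rho> ^ k) * b) / \<rho> ^ k"
          using that by simp
        then have "b * \<rho> ^ k \<le> C * (a - (1 - \<rho> ^ k) * b)"
          using r by (simp only: pos_le_divide_eq)
        then have "b * \<rho> ^ k / C \<le> a - (1 - \<rho> ^ k) * b"
          using C by (simp add: pos_divide_le_eq mult.commute)
        moreover have "(1 - \<rho> ^ Suc k) * b = b * \<rho> ^ k / C + (1 - \<rho> ^ k) * b"
          unfolding power_Suc by (subst \<rho>_def) (simp add: algebra_simps)
        ultimately show ?thesis
          by linarith
      qed
      ultimately show ?thesis
        unfolding M_def by blast
    qed
  qed
  have "(\<lambda>k. (1 - \<rho> ^ k) * \<Lambda>' f) \<longlonglongrightarrow> (1 - 0) * \<Lambda>' f"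
    using \<rho> by (intro tendsto_intros LIMSEQ_realpow_zero) auto
  then show ?thesis
    using le f by (intro LIMSEQ_le_const2[of _ "\<Lambda>' f"]) auto
qed

lemma conformal_mean_unique:
  assumes \<beta>: "\<beta> \<notin> \<rat>"
    and V: "continuous_on UNIV V" "variation_majorant T W V" "(\<integral>y. V y \<partial>circle_lebesgue) = 0"
    and \<Lambda>: "conformal_mean \<beta> V \<Lambda>" and \<Lambda>': "conformal_mean \<beta> V \<Lambda>'"
    and f: "continuous_on UNIV f"
  shows "\<Lambda>' f = \<Lambda> f"
proof -
  obtain M where M: "\<And>y. \<bar>f y\<bar> \<le> M"
    using continuous_circle_bounded[OF f] by blast
  have cont: "continuous_on UNIV (\<lambda>y. f y + M)"
    by (intro continuous_intros f)
  have nonneg: "0 \<le> f y + M" for y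
    using M[of y] by linarith
  have shift: "\<Phi> (\<lambda>y. f y + M) = \<Phi> f + M" if "conformal_mean \<beta> V \<Phi>" for \<Phi>
    using that f positive_functional_add[of \<Phi> f "\<lambda>_. M"] positive_functional_scale[of \<Phi> "\<lambda>_. 1" M]
    by (simp add: conformal_mean_def)
  show ?thesis
    using conformal_mean_le[OF \<beta> V \<Lambda> \<Lambda>' cont nonneg] conformal_mean_le[OF \<beta> V \<Lambda>' \<Lambda> cont nonneg]
    unfolding shift[OF \<Lambda>] shift[OF \<Lambda>'] by linarith
qed


section \<open>Stationary measures of nearest neighbour walks\<close>

text \<open>The walk on the orbits of the rotation by \<open>\<beta>\<close> that jumps to the right with rate \<open>a\<close> and to the left
  with rate \<open>b\<close>. Here \<open>V\<close> is \<open>log (a/b)\<close>, and its mean being zero expresses that neither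
  direction is preferred on average.\<close>

locale rotation_walk =
  fixes \<beta> :: real and a b V :: "circle \<Rightarrow> real" and T :: "real \<Rightarrow> real" and W :: real
  assumes irrational: "\<beta> \<notin> \<rat>"
    and cont_a: "continuous_on UNIV a" and cont_b: "continuous_on UNIV b"
    and cont_V: "continuous_on UNIV V"
    and pos_b: "\<And>y. 0 < b y"
    and ratio: "\<And>y. exp (V y) * b y = a y"
    and variation: "variation_majorant T W V"
    and symmetric: "(\<integral>y. V y \<partial>circle_lebesgue) = 0"
begin

definition generator :: "(circle \<Rightarrow> real) \<Rightarrow> circle \<Rightarrow> real"
  where "generator \<phi> y =
    a y * (\<phi> (y + to_circle \<beta>) - \<phi> y) + b y * (\<phi> (y - to_circle \<beta>) - \<phi> y)"

definition invariant :: "circle measure \<Rightarrow> bool"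
  where "invariant \<nu> \<longleftrightarrow> prob_space \<nu> \<and> sets \<nu> = sets borel \<and>
    (\<forall>\<phi> :: circle \<Rightarrow> real. continuous_on UNIV \<phi> \<longrightarrow> (\<integral>y. generator \<phi> y \<partial>\<nu>) = 0)"

text \<open>Jensen's inequality: the exponent has mean zero.\<close>

lemma orbit_weight_mean:
  "1 \<le> (\<integral>y. orbit_weight \<beta> V j y \<partial>circle_lebesgue)"
proof -
  interpret prob_space circle_lebesgue
    by (rule prob_space_circle_lebesgue)
  have int: "integrable circle_lebesgue f" if "continuous_on UNIV f" for f :: "circle \<Rightarrow> real"
    using continuous_circle_integrable[OF that sets_circle_lebesgue finite_measure_axioms] .
  have "(\<integral>y. 1 + birkhoff \<beta> V j y \<partial>circle_lebesgue) \<le> (\<integral>y. orbit_weight \<beta> V j y \<partial>circle_lebesgue)"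
    by (intro integral_mono int continuous_intros continuous_birkhoff continuous_orbit_weight cont_V)
      (simp add: orbit_weight_def exp_ge_add_one_self)
  moreover have "(\<integral>y. 1 + birkhoff \<beta> V j y \<partial>circle_lebesgue) = 1"
    using int[OF continuous_birkhoff[OF cont_V]] by (simp add: birkhoff_lebesgue[OF cont_V] symmetric prob_space)
  ultimately show ?thesis
    by simp
qed

text \<open>Stationarity says exactly that the flux functional is invariant under the rotation. Averaging along
  orbits then identifies it as \<open>\<kappa>\<close> times Lebesgue measure. Testing it on the orbit weights
  gives the recursion \<open>r\<^sub>j\<^sub>+\<^sub>1 = r\<^sub>j + \<kappa> \<integral> orbit_weight j\<close> for their integrals \<open>r\<^sub>j\<close> against
  \<open>b \<nu>\<close>, so that \<open>r\<^sub>j\<close> moves away from \<open>r\<^sub>0\<close> by at least \<open>\<bar>\<kappa>\<bar> j\<close>. This contradicts the Denjoy-Koksma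
  bound if \<open>\<kappa> > 0\<close>, and \<open>r\<^sub>j \<ge> 0\<close> if \<open>\<kappa> < 0\<close>.\<close>

lemma no_flux:
  assumes \<nu>: "invariant \<nu>" and \<phi>: "continuous_on UNIV \<phi>"
  shows "(\<integral>y. a y * \<phi> (y + to_circle \<beta>) \<partial>\<nu>) = (\<integral>y. b y * \<phi> y \<partial>\<nu>)"
proof -
  interpret prob_space \<nu>
    using \<nu> by (simp add: invariant_def)
  have int: "integrable \<nu> f" if "continuous_on UNIV f" for f :: "circle \<Rightarrow> real"
    using continuous_circle_integrable[OF that _ finite_measure_axioms] \<nu> by (simp add: invariant_def)
  have int_a: "integrable \<nu> (\<lambda>y. a y * f (y + c))" and int_b: "integrable \<nu> (\<lambda>y. b y * f (y + c))"
    if "continuous_on UNIV f" for f :: "circle \<Rightarrow> real" and c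
    by (intro int continuous_on_mult cont_a cont_b continuous_circle_shift that)+
  have int_b0: "integrable \<nu> (\<lambda>y. b y * f y)" if "continuous_on UNIV f" for f :: "circle \<Rightarrow> real"
    using int_b[OF that, of 0] by simp
  define flux where "flux f = (\<integral>y. a y * f (y + to_circle \<beta>) \<partial>\<nu>) - (\<integral>y. b y * f y \<partial>\<nu>)" for f
  have shift1: "flux (\<lambda>y. f (y + to_circle \<beta>)) = flux f" if f: "continuous_on UNIV f" for f
  proof -
    have "(\<lambda>y. generator (\<lambda>y. f (y + to_circle \<beta>)) y) = (\<lambda>y.
        (a y * f (y + (to_circle \<beta> + to_circle \<beta>)) - a y * f (y + to_circle \<beta>))
        + (b y * f y - b y * f (y + to_circle \<beta>)))"
      by (simp add: generator_def add.assoc right_diff_distrib)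
    moreover have "(\<integral>y. generator (\<lambda>y. f (y + to_circle \<beta>)) y \<partial>\<nu>) = 0"
      using \<nu> continuous_circle_shift[OF f] by (simp add: invariant_def)
    ultimately show ?thesis
      using f by (simp add: flux_def int_a int_b int_b0 add.assoc)
  qed
  have shift: "flux (\<lambda>y. f (y + to_circle (real k * \<beta>))) = flux f" if f: "continuous_on UNIV f" for f k
  proof (induction k)
    case (Suc k)
    have "(\<lambda>y. f (y + to_circle (real (Suc k) * \<beta>)))
        = (\<lambda>y. f (y + to_circle \<beta> + to_circle (real k * \<beta>)))"
      by (simp add: distrib_right to_circle_add add.assoc)
    then show ?case
      using shift1[OF continuous_circle_shift[OF f]] Suc by simp
  qed simp
  have birkhoff: "flux (birkhoff \<beta> f n) = real n * flux f" if f: "continuous_on UNIV f" for f n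
  proof -
    have "flux (birkhoff \<beta> f n) = (\<Sum>k<n. flux (\<lambda>y. f (y + to_circle (real k * \<beta>))))"
      unfolding flux_def birkhoff_def[abs_def] sum_distrib_left sum_subtractf
      by (simp add: int_a[OF continuous_circle_shift[OF f]] int_b[OF f])
    then show ?thesis
      by (simp add: shift[OF f])
  qed
  define \<kappa> where "\<kappa> = flux (\<lambda>_. 1)"
  obtain A B where A: "0 < A" "\<And>y. \<bar>a y\<bar> \<le> A" and B: "0 < B" "\<And>y. \<bar>b y\<bar> \<le> B"
    using continuous_circle_bounded[OF cont_a] continuous_circle_bounded[OF cont_b] by metis
  have abs_integral_le: "\<bar>\<integral>y. g y \<partial>\<nu>\<bar> \<le> c" if "integrable \<nu> g" "\<And>y. \<bar>g y\<bar> \<le> c"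
    for g :: "circle \<Rightarrow> real" and c
  proof -
    have "g y \<le> c" "- c \<le> g y" for y
      using that(2)[of y] by auto
    then show ?thesis
      using integral_le_const[OF that(1), of c] integral_ge_const[OF that(1), of "- c"]
      by (simp add: abs_le_iff)
  qed
  have close: "\<bar>flux f - I * \<kappa>\<bar> \<le> (A + B) * e"
    if f: "continuous_on UNIV f" and e: "\<And>y. \<bar>f y - I\<bar> \<le> e" for f I e
  proof -
    have cI: "continuous_on UNIV (\<lambda>y. f y - I)"
      by (intro continuous_intros f)
    have "flux f - I * \<kappa> = flux (\<lambda>y. f y - I)"
      using f int[OF cont_a] int[OF cont_b]
      by (simp add: flux_def \<kappa>_def int_a int_b0 right_diff_distrib algebra_simps)
    moreover have "\<bar>\<integral>y. a y * (f (y + to_circle \<beta>) - I) \<partial>\<nu>\<bar> \<le> A * e"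
      using A(1) by (intro abs_integral_le int_a[OF cI]) (auto simp: abs_mult intro!: mult_mono A e)
    moreover have "\<bar>\<integral>y. b y * (f y - I) \<partial>\<nu>\<bar> \<le> B * e"
      using B(1) by (intro abs_integral_le int_b0[OF cI]) (auto simp: abs_mult intro!: mult_mono B e)
    ultimately show ?thesis
      unfolding flux_def distrib_right by linarith
  qed
  have lebesgue: "flux f = (\<integral>y. f y \<partial>circle_lebesgue) * \<kappa>" if f: "continuous_on UNIV f" for f
  proof -
    have "\<bar>flux f - (\<integral>y. f y \<partial>circle_lebesgue) * \<kappa>\<bar> \<le> 0 + e" if "0 < e" for e
    proof -
      have "0 < e / (A + B)"
        using that A B by simp
      from birkhoff_average[OF f irrational this] obtain n where n: "0 < n"
        "\<And>y. \<bar>birkhoff \<beta> f n y / real n - (\<integral>y. f y \<partial>circle_lebesgue)\<bar> \<le> e / (A + B)"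
        by blast
      have c: "continuous_on UNIV (\<lambda>y. birkhoff \<beta> f n y / real n)"
        using n(1) by (intro continuous_intros continuous_birkhoff f) simp
      have "flux (\<lambda>y. birkhoff \<beta> f n y / real n) = flux (birkhoff \<beta> f n) / real n"
        by (simp add: flux_def diff_divide_distrib)
      also have "\<dots> = flux f"
        using n(1) by (simp add: birkhoff[OF f])
      finally show ?thesis
        using close[OF c n(2)] A B by simp
    qed
    then have "\<bar>flux f - (\<integral>y. f y \<partial>circle_lebesgue) * \<kappa>\<bar> \<le> 0"
      by (rule field_le_epsilon)
    then show ?thesis
      by simp
  qed
  define r where "r j = (\<integral>y. b y * orbit_weight \<beta> V j y \<partial>\<nu>)" for j
  have cont_E: "continuous_on UNIV (orbit_weight \<beta> V j)" for j
    by (intro continuous_orbit_weight cont_V)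
  have r_Suc: "r (Suc j) = r j + (\<integral>y. orbit_weight \<beta> V j y \<partial>circle_lebesgue) * \<kappa>" for j
  proof -
    have "b y * orbit_weight \<beta> V (Suc j) y = a y * orbit_weight \<beta> V j (y + to_circle \<beta>)" for y
      by (simp add: orbit_weight_def birkhoff_Suc exp_add ratio[symmetric])
    then have "r (Suc j) = r j + flux (orbit_weight \<beta> V j)"
      by (simp add: r_def flux_def)
    then show ?thesis
      by (simp add: lebesgue[OF cont_E])
  qed
  have r_pos: "0 \<le> r j" for j
    unfolding r_def using pos_b orbit_weight_pos
    by (intro Bochner_Integration.integral_nonneg mult_nonneg_nonneg) (auto simp: less_imp_le)
  have r_bound: "r n \<le> exp (12 * W) * r 0" if cf: "dirichlet_fraction \<beta> m n" for m n
  proof -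
    have "b y * orbit_weight \<beta> V n y \<le> exp (12 * W) * (b y * orbit_weight \<beta> V 0 y)" for y
    proof -
      have "birkhoff \<beta> V n y \<le> 12 * W"
        using denjoy_koksma[OF cont_V variation cf, of y] by (simp add: symmetric)
      then have "b y * orbit_weight \<beta> V n y \<le> b y * exp (12 * W)"
        using pos_b[of y] by (intro mult_left_mono) (auto simp: orbit_weight_def)
      then show ?thesis
        by (simp add: orbit_weight_def mult.commute)
    qed
    then have "r n \<le> (\<integral>y. exp (12 * W) * (b y * orbit_weight \<beta> V 0 y) \<partial>\<nu>)"
      unfolding r_def using int_b0[OF cont_E] by (intro integral_mono) auto
    then show ?thesis
      by (simp add: r_def)
  qed
  have "\<kappa> = 0"
  proof (rule ccontr)
    assume "\<kappa> \<noteq> 0"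
    then consider "0 < \<kappa>" | "\<kappa> < 0"
      by linarith
    then show False
    proof cases
      case 1
      have lower: "\<kappa> * real n \<le> r n" for n
      proof (induction n)
        case (Suc n)
        have "1 * \<kappa> \<le> (\<integral>y. orbit_weight \<beta> V n y \<partial>circle_lebesgue) * \<kappa>"
          using 1 orbit_weight_mean by (intro mult_right_mono) auto
        then show ?case
          using Suc by (simp add: r_Suc algebra_simps)
      qed (simp add: r_pos)
      obtain m n where n: "dirichlet_fraction \<beta> m n" "nat \<lceil>exp (12 * W) * r 0 / \<kappa>\<rceil> < n"
        using dirichlet_fraction_large[OF irrational] by blast
      have "exp (12 * W) * r 0 / \<kappa> < real n"
        using n(2) by linarith
      then have "exp (12 * W) * r 0 < \<kappa> * real n"
        using 1 by (simp add: pos_divide_less_eq mult.commute)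
      then show False
        using lower[of n] r_bound[OF n(1)] by linarith
    next
      case 2
      have upper: "r n \<le> r 0 + \<kappa> * real n" for n
      proof (induction n)
        case (Suc n)
        have "(\<integral>y. orbit_weight \<beta> V n y \<partial>circle_lebesgue) * \<kappa> \<le> 1 * \<kappa>"
          using 2 orbit_weight_mean by (intro mult_right_mono_neg) auto
        then show ?case
          using Suc by (simp add: r_Suc algebra_simps)
      qed simp
      obtain n where "r 0 / (- \<kappa>) < real n"
        using reals_Archimedean2 by blast
      then have "r 0 < real n * (- \<kappa>)"
        using 2 pos_divide_less_eq[of "- \<kappa>" "r 0" "real n"] by simp
      then have "r 0 + \<kappa> * real n < 0"
        by (simp add: mult.commute)
      then show False
        using upper[of n] r_pos[of n] by linarith
    qed
  qed
  then show ?thesis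
    using lebesgue[OF \<phi>] by (simp add: flux_def)
qed

text \<open>Detailed balance \<open>a(y) \<nu>(dy) = b(y+\<beta>) \<nu>(dy+\<beta>)\<close>, as expressed by the vanishing flux, is the conformal
  relation for \<open>b \<nu>\<close>, because \<open>a = exp V \<sqdot> b\<close>.\<close>

lemma invariant_conformal:
  assumes \<nu>: "invariant \<nu>"
  shows "0 < (\<integral>y. b y \<partial>\<nu>)" (is ?pos)
    and "conformal_mean \<beta> V (\<lambda>\<phi>. (\<integral>y. b y * \<phi> y \<partial>\<nu>) / (\<integral>y. b y \<partial>\<nu>))" (is ?mean)
proof -
  interpret prob_space \<nu>
    using \<nu> by (simp add: invariant_def)
  have int: "integrable \<nu> f" if "continuous_on UNIV f" for f :: "circle \<Rightarrow> real"
    using continuous_circle_integrable[OF that _ finite_measure_axioms] \<nu> by (simp add: invariant_def)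
  have int_b: "integrable \<nu> (\<lambda>y. b y * f y)" if "continuous_on UNIV f" for f :: "circle \<Rightarrow> real"
    by (intro int continuous_on_mult cont_b that)
  obtain m where m: "0 < m" "\<And>y. m \<le> b y"
    using continuous_circle_positive[OF cont_b pos_b] by blast
  have "m \<le> (\<integral>y. b y \<partial>\<nu>)"
    using m by (intro integral_ge_const int cont_b AE_I2)
  then show pos: ?pos
    using m by simp
  show ?mean
    unfolding conformal_mean_def positive_functional_def
  proof (intro conjI allI impI)
    fix f g :: "circle \<Rightarrow> real" and c :: real
    assume f: "continuous_on UNIV f"
    show "(\<integral>y. b y * (c * f y) \<partial>\<nu>) / (\<integral>y. b y \<partial>\<nu>) = c * ((\<integral>y. b y * f y \<partial>\<nu>) / (\<integral>y. b y \<partial>\<nu>))"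
      by (simp add: mult.left_commute[of _ c])
    show "0 \<le> (\<integral>y. b y * f y \<partial>\<nu>) / (\<integral>y. b y \<partial>\<nu>)" if "\<forall>y. 0 \<le> f y"
      using that pos pos_b
      by (intro divide_nonneg_pos Bochner_Integration.integral_nonneg mult_nonneg_nonneg)
        (auto simp: less_imp_le)
    have eq: "(\<lambda>y. b y * (exp (V y) * f (y + to_circle \<beta>))) = (\<lambda>y. a y * f (y + to_circle \<beta>))"
      by (simp add: ratio[symmetric] fun_eq_iff)
    show "(\<integral>y. b y * (exp (V y) * f (y + to_circle \<beta>)) \<partial>\<nu>) / (\<integral>y. b y \<partial>\<nu>)
        = (\<integral>y. b y * f y \<partial>\<nu>) / (\<integral>y. b y \<partial>\<nu>)"
      unfolding eq no_flux[OF \<nu> f] ..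
    show "(\<integral>y. b y * (f y + g y) \<partial>\<nu>) / (\<integral>y. b y \<partial>\<nu>)
        = (\<integral>y. b y * f y \<partial>\<nu>) / (\<integral>y. b y \<partial>\<nu>) + (\<integral>y. b y * g y \<partial>\<nu>) / (\<integral>y. b y \<partial>\<nu>)"
      if "continuous_on UNIV g"
      by (simp add: distrib_left int_b[OF f] int_b[OF that] add_divide_distrib)
  qed (use pos in simp)
qed

theorem invariant_unique:
  assumes \<mu>: "invariant \<mu>" and \<nu>: "invariant \<nu>"
  shows "\<mu> = \<nu>"
proof (rule circle_measure_eqI)
  show "prob_space \<mu>" "sets \<mu> = sets borel" "prob_space \<nu>" "sets \<nu> = sets borel"
    using \<mu> \<nu> by (simp_all add: invariant_def)
  have means: "(\<integral>y. \<phi> y \<partial>\<mu>) / (\<integral>y. b y \<partial>\<mu>) = (\<integral>y. \<phi> y \<partial>\<nu>) / (\<integral>y. b y \<partial>\<nu>)"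
    if \<phi>: "continuous_on UNIV \<phi>" for \<phi> :: "circle \<Rightarrow> real"
  proof -
    have c: "continuous_on UNIV (\<lambda>y. \<phi> y / b y)"
      using pos_b by (intro continuous_on_divide \<phi> cont_b) (auto simp: less_imp_neq[symmetric])
    have "b y * (\<phi> y / b y) = \<phi> y" for y
      using pos_b[of y] by simp
    then show ?thesis
      using conformal_mean_unique[OF irrational cont_V variation symmetric
          invariant_conformal(2)[OF \<nu>] invariant_conformal(2)[OF \<mu>] c]
      by simp
  qed
  have "(\<integral>y. b y \<partial>\<mu>) = (\<integral>y. b y \<partial>\<nu>)"
    using means[of "\<lambda>_. 1"] \<open>prob_space \<mu>\<close> \<open>prob_space \<nu>\<close>
      invariant_conformal(1)[OF \<mu>] invariant_conformal(1)[OF \<nu>]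
    by (simp add: prob_space.prob_space)
  then show "(\<integral>y. \<phi> y \<partial>\<mu>) = (\<integral>y. \<phi> y \<partial>\<nu>)" if "continuous_on UNIV \<phi>" for \<phi> :: "circle \<Rightarrow> real"
    using means[OF that] invariant_conformal(1)[OF \<nu>] by simp
qed

end


section \<open>Lazy operators\<close>

text \<open>The hypothesis \<open>lazy\<close> expresses that \<open>L f = \<epsilon> f + (1 - \<epsilon>) R f\<close> for an averaging operator \<open>R\<close>.
  Let \<open>D\<close> be the limit of the decreasing upper bounds of the increments \<open>\<psi>\<^sub>n\<close>, and suppose that \<open>D > 0\<close>.
  Choose \<open>N\<close> with \<open>\<psi>\<^sub>N\<close> nearly at most \<open>D\<close> and, for a large \<open>m\<close>, a point \<open>y\<close> where
  \<open>\<psi>\<^sub>N\<^sub>+\<^sub>m\<close> is nearly \<open>D\<close>. Since \<open>\<psi>\<^sub>n\<^sub>+\<^sub>1(y)\<close> gives the weight \<open>\<epsilon>\<close> to \<open>\<psi>\<^sub>n(y)\<close> and the rest to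
  values that hardly exceed \<open>D\<close>, the previous increments \<open>\<psi>\<^sub>n(y)\<close> at the same point are
  close to \<open>D\<close> too. Their telescoping sum is about \<open>m D\<close>, although \<open>L\<^sup>n f\<close> stays bounded.\<close>

lemma lazy_operator_increments_le:
  fixes L :: "('a \<Rightarrow> real) \<Rightarrow> 'a \<Rightarrow> real"
  assumes diff: "\<And>f g. L (\<lambda>y. f y - g y) = (\<lambda>y. L f y - L g y)"
    and \<epsilon>: "0 < \<epsilon>" "\<epsilon> \<le> 1"
    and lazy: "\<And>f M y. (\<And>z. f z \<le> M) \<Longrightarrow> L f y \<le> \<epsilon> * f y + (1 - \<epsilon>) * M"
    and f: "\<And>y. \<bar>f y\<bar> \<le> B" and e: "0 < e"
  shows "\<exists>N. \<forall>n\<ge>N. \<forall>y. (L ^^ Suc n) f y - (L ^^ n) f y \<le> e"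
proof (rule ccontr)
  assume "\<not> ?thesis"
  then have large: "\<exists>n\<ge>N. \<exists>y. e < (L ^^ Suc n) f y - (L ^^ n) f y" for N
    by (simp add: not_le)
  define \<psi> where "\<psi> n y = (L ^^ Suc n) f y - (L ^^ n) f y" for n y
  have \<psi>_Suc: "\<psi> (Suc n) = L (\<psi> n)" for n
    using diff[of "(L ^^ Suc n) f" "(L ^^ n) f"] by (simp add: \<psi>_def[abs_def])
  have L_le: "L g y \<le> M" if "\<And>z. g z \<le> M" for g M y
  proof -
    have "\<epsilon> * g y \<le> \<epsilon> * M"
      using that \<epsilon> by (intro mult_left_mono) auto
    then show ?thesis
      using lazy[of g M y, OF that] by (simp add: algebra_simps)
  qed
  have L_minus: "L (\<lambda>y. - g y) = (\<lambda>y. - L g y)" for g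
    using diff[of "\<lambda>_. 0" g] diff[of "\<lambda>_. 0" "\<lambda>_. 0"] by simp
  have bound: "\<bar>(L ^^ n) f y\<bar> \<le> B" for n y
  proof (induction n arbitrary: y)
    case (Suc n)
    have "L ((L ^^ n) f) y \<le> B" "L (\<lambda>y. - (L ^^ n) f y) y \<le> B"
      by (intro L_le; use Suc in \<open>simp add: abs_le_iff\<close>)+
    then show ?case
      by (simp add: L_minus abs_le_iff)
  qed (use f in simp)
  define D where "D = Inf {M. \<exists>n. \<forall>y. \<psi> n y \<le> M}"
  have persist: "\<psi> (n + k) y \<le> M" if "\<And>y. \<psi> n y \<le> M" for n k M y
  proof (induction k arbitrary: y)
    case (Suc k)
    then show ?case
      using L_le[of "\<psi> (n + k)" M] by (simp add: \<psi>_Suc)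
  qed (use that in simp)
  have lower: "e \<le> M" if "M \<in> {M. \<exists>n. \<forall>y. \<psi> n y \<le> M}" for M
  proof -
    obtain n where n: "\<And>y. \<psi> n y \<le> M"
      using \<open>M \<in> _\<close> by blast
    obtain n' y where "n \<le> n'" "e < \<psi> n' y"
      using large[of n] unfolding \<psi>_def by blast
    then show ?thesis
      using persist[OF n, of "n' - n" y] by simp
  qed
  have "\<psi> 0 y \<le> 2 * B" for y
    using bound[of 1 y] bound[of 0 y] by (simp add: \<psi>_def)
  then have ne: "{M. \<exists>n. \<forall>y. \<psi> n y \<le> M} \<noteq> {}"
    by blast
  have D: "e \<le> D"
    unfolding D_def using ne lower by (intro cInf_greatest) auto
  obtain m :: nat where m: "2 * B < real m * (D / 2)"
    using reals_Archimedean3[of "D / 2", THEN spec, of "2 * B"] D e by auto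
  define c where "c = (2 / \<epsilon>) ^ m"
  have base: "1 \<le> 2 / \<epsilon>"
    using \<epsilon> by simp
  then have c: "1 \<le> c"
    unfolding c_def by (rule one_le_power)
  \<comment> \<open>Each step backwards in time multiplies the error by at most \<open>2 / \<epsilon>\<close>. With this \<open>\<eta>\<close>,
    at most half of \<open>D\<close> is lost after \<open>m\<close> steps.\<close>
  define \<eta> where "\<eta> = D / (2 * c)"
  have \<eta>: "0 < \<eta>" "c * \<eta> = D / 2"
    using D e c by (auto simp: \<eta>_def)
  have "\<exists>M\<in>{M. \<exists>n. \<forall>y. \<psi> n y \<le> M}. M < D + \<eta>"
    using cInf_lessD[OF ne, of "D + \<eta>"] \<eta>(1) unfolding D_def by simp
  then obtain M N where MN: "M < D + \<eta>" "\<And>y. \<psi> N y \<le> M"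
    by blast
  have N: "\<psi> N y \<le> D + \<eta>" for y
    using MN(1) MN(2)[of y] by linarith
  have "\<exists>y. D - \<eta> < \<psi> (N + m) y"
  proof (rule ccontr)
    assume "\<not> ?thesis"
    then have "D - \<eta> \<in> {M. \<exists>n. \<forall>y. \<psi> n y \<le> M}"
      by (auto simp: not_less)
    then have "D \<le> D - \<eta>"
      unfolding D_def using lower by (intro cInf_lower bdd_belowI) auto
    then show False
      using \<eta>(1) by simp
  qed
  then obtain y where y: "D - \<eta> < \<psi> (N + m) y"
    by blast
  have backward: "D - (2 / \<epsilon>) ^ k * \<eta> \<le> \<psi> (N + m - k) y" if "k \<le> m" for k
    using that
  proof (induction k)
    case 0
    then show ?case
      using y by simp
  next
    case (Suc k)
    define q where "q = (2 / \<epsilon>) ^ k"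
    have q: "1 \<le> q"
      unfolding q_def using base by (rule one_le_power)
    define i where "i = m - Suc k"
    have i: "N + m - k = Suc (N + i)" "N + m - Suc k = N + i"
      using Suc.prems by (auto simp: i_def)
    have "D - q * \<eta> \<le> \<psi> (Suc (N + i)) y"
      using Suc by (simp add: q_def i(1))
    also have "\<dots> \<le> \<epsilon> * \<psi> (N + i) y + (1 - \<epsilon>) * (D + \<eta>)"
      unfolding \<psi>_Suc by (rule lazy) (rule persist[OF N])
    finally have "\<epsilon> * D - (q + 1) * \<eta> + \<epsilon> * \<eta> \<le> \<epsilon> * \<psi> (N + i) y"
      by (simp add: algebra_simps)
    moreover have "(q + 1) * \<eta> \<le> 2 * q * \<eta>"
      using q \<eta>(1) by (intro mult_right_mono) auto
    moreover have "0 < \<epsilon> * \<eta>"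
      using \<epsilon> \<eta> by simp
    ultimately have "\<epsilon> * D - 2 * q * \<eta> \<le> \<epsilon> * \<psi> (N + i) y"
      by linarith
    moreover have "\<epsilon> * (D - (2 / \<epsilon>) ^ Suc k * \<eta>) = \<epsilon> * D - 2 * q * \<eta>"
      using \<epsilon>(1) by (simp add: q_def right_diff_distrib)
    ultimately have "\<epsilon> * (D - (2 / \<epsilon>) ^ Suc k * \<eta>) \<le> \<epsilon> * \<psi> (N + i) y"
      by simp
    then show ?case
      using \<epsilon>(1) unfolding i(2) by (simp only: mult_le_cancel_left_pos)
  qed
  have half: "D / 2 \<le> \<psi> (N + j) y" if "j < m" for j
  proof -
    have "(2 / \<epsilon>) ^ (m - j) \<le> c"
      unfolding c_def using base by (intro power_increasing) auto
    then have "(2 / \<epsilon>) ^ (m - j) * \<eta> \<le> D / 2"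
      using \<eta> by (metis less_imp_le mult_right_mono)
    then show ?thesis
      using backward[of "m - j"] that by simp
  qed
  have "real m * (D / 2) = (\<Sum>j<m. D / 2)"
    by simp
  also have "\<dots> \<le> (\<Sum>j<m. \<psi> (N + j) y)"
    using half by (intro sum_mono) simp
  also have "\<dots> = (L ^^ (N + m)) f y - (L ^^ N) f y"
    using sum_lessThan_telescope[of "\<lambda>j. (L ^^ (N + j)) f y" m] by (simp add: \<psi>_def)
  also have "\<dots> \<le> 2 * B"
    using bound[of "N + m" y] bound[of N y] by simp
  finally show False
    using m by simp
qed

lemma lazy_operator_increments:
  fixes L :: "('a \<Rightarrow> real) \<Rightarrow> 'a \<Rightarrow> real"
  assumes diff: "\<And>f g. L (\<lambda>y. f y - g y) = (\<lambda>y. L f y - L g y)"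
    and \<epsilon>: "0 < \<epsilon>" "\<epsilon> \<le> 1"
    and lazy: "\<And>f M y. (\<And>z. f z \<le> M) \<Longrightarrow> L f y \<le> \<epsilon> * f y + (1 - \<epsilon>) * M"
    and f: "\<And>y. \<bar>f y\<bar> \<le> B"
  shows "(\<lambda>n. (L ^^ Suc n) f y - (L ^^ n) f y) \<longlonglongrightarrow> 0"
proof (rule LIMSEQ_I)
  fix e :: real assume "0 < e"
  then have e: "0 < e / 2"
    by simp
  have minus: "(L ^^ n) (\<lambda>y. - f y) = (\<lambda>y. - (L ^^ n) f y)" for n
  proof (induction n)
    case (Suc n)
    then show ?case
      using diff[of "\<lambda>_. 0" "(L ^^ n) f"] diff[of "\<lambda>_. 0" "\<lambda>_. 0"] by simp
  qed simp
  have increments: "\<exists>N. \<forall>n\<ge>N. \<forall>y. (L ^^ Suc n) g y - (L ^^ n) g y \<le> e / 2"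
    if "\<And>y. \<bar>g y\<bar> \<le> B" for g
    by (rule lazy_operator_increments_le[where \<epsilon> = \<epsilon> and B = B]) (fact diff \<epsilon> lazy that e)+
  obtain N where N: "\<And>n. N \<le> n \<Longrightarrow> (L ^^ Suc n) f y - (L ^^ n) f y \<le> e / 2"
    using increments[of f, OF f] by blast
  have "\<bar>- f y\<bar> \<le> B" for y
    using f by simp
  from increments[of "\<lambda>y. - f y", OF this] obtain N' where
    N': "\<And>n. N' \<le> n \<Longrightarrow> (L ^^ Suc n) (\<lambda>y. - f y) y - (L ^^ n) (\<lambda>y. - f y) y \<le> e / 2"
    by blast
  have "norm ((L ^^ Suc n) f y - (L ^^ n) f y - 0) < e" if "max N N' \<le> n" for n
  proof -
    have "(L ^^ Suc n) f y - (L ^^ n) f y \<le> e / 2" "- (L ^^ Suc n) f y + (L ^^ n) f y \<le> e / 2"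
      using N[of n] N'[of n] that unfolding minus by simp_all
    then show ?thesis
      using \<open>0 < e\<close> by (simp only: real_norm_def diff_0_right abs_less_iff) linarith
  qed
  then show "\<exists>no. \<forall>n\<ge>no. norm ((L ^^ Suc n) f y - (L ^^ n) f y - 0) < e"
    by blast
qed


section \<open>Expectations and weak limits\<close>

text \<open>The Markov property in the form that is needed: the law of the first \<open>n + 2\<close> coordinates is the law
  of the first \<open>n + 1\<close> of them bound to the kernel.\<close>

lemma markov_law_expectation_Suc:
  fixes \<mu> :: "'s :: topological_space measure" and f :: "'s \<Rightarrow> real"
  assumes mu: "prob_space \<mu>" "sets \<mu> = sets borel"
    and K: "K \<in> borel \<rightarrow>\<^sub>M subprob_algebra borel" "\<And>s. prob_space (K s)"
    and f: "f \<in> borel_measurable borel" "\<And>s. \<bar>f s\<bar> \<le> B"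
  shows "(\<integral>X. f (X (Suc n)) \<partial>markov_law \<mu> K) = (\<integral>X. (\<integral>s. f s \<partial>K (X n)) \<partial>markov_law \<mu> K)"
proof -
  interpret IT: Ionescu_Tulcea "markov_step \<mu> K" "\<lambda>_. borel"
    using mu K by (rule Ionescu_Tulcea_markov_step)
  interpret law: prob_space "markov_law \<mu> K"
    using mu K by (rule prob_space_markov_law)
  define M where "M k = PiM {0..<k} (\<lambda>_. borel :: 's measure)" for k :: nat
  define R where "R k = distr (markov_law \<mu> K) (M k) (\<lambda>\<omega>. restrict \<omega> {0..<k})" for k
  define N where "N \<omega> = distr (K (\<omega> n)) (M (Suc (Suc n))) (fun_upd \<omega> (Suc n))" for \<omega>
  have sets: "sets (markov_law \<mu> K) = sets (PiM UNIV (\<lambda>_. borel))"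
    using mu K by (rule sets_markov_law)
  have restr: "(\<lambda>\<omega>. restrict \<omega> {0..<k}) \<in> markov_law \<mu> K \<rightarrow>\<^sub>M M k" for k
    unfolding M_def measurable_cong_sets[OF sets refl] by (rule measurable_restrict_subset) simp
  have coord: "(\<lambda>\<omega>. \<omega> j) \<in> M k \<rightarrow>\<^sub>M borel" if "j < k" for j k
    unfolding M_def using that by (intro measurable_component_singleton) auto
  have setsK: "sets (K s) = sets borel" for s
    using measurable_space[OF K(1), of s] by (simp add: space_subprob_algebra)
  have fK: "f \<in> borel_measurable (K s)" for s
    using f(1) measurable_cong_sets[OF setsK refl] by blast
  have R_Suc: "R (Suc (Suc n)) = R (Suc n) \<bind> N"
    unfolding R_def N_def[abs_def] M_def using mu K by (rule markov_law_Suc)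
  have N: "N \<in> R (Suc n) \<rightarrow>\<^sub>M subprob_algebra (M (Suc (Suc n)))"
  proof -
    have "IT.eP (Suc n) \<in> M (Suc n) \<rightarrow>\<^sub>M subprob_algebra (M (Suc (Suc n)))"
      unfolding M_def by (rule IT.measurable_eP)
    moreover have "IT.eP (Suc n) = N"
      by (simp add: fun_eq_iff IT.eP_def N_def M_def markov_step_def)
    moreover have "sets (R (Suc n)) = sets (M (Suc n))"
      by (simp add: R_def)
    ultimately show ?thesis
      using measurable_cong_sets[of "R (Suc n)" "M (Suc n)"] by simp
  qed
  have R_prob: "prob_space (R k)" for k
    unfolding R_def by (rule law.prob_space_distr[OF restr])
  have inner: "(\<integral>\<omega>'. f (\<omega>' (Suc n)) \<partial>N \<omega>) = (\<integral>s. f s \<partial>K (\<omega> n))" if "\<omega> \<in> space (R (Suc n))" for \<omega>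
  proof -
    have "\<omega> \<in> space (PiM {0..<Suc n} (\<lambda>_. borel))"
      using that by (simp add: R_def M_def)
    then have "fun_upd \<omega> (Suc n) \<in> borel \<rightarrow>\<^sub>M M (Suc (Suc n))"
      unfolding M_def
      by (intro measurable_fun_upd[where J = "{0..<Suc n}"] measurable_const measurable_ident) auto
    then have "fun_upd \<omega> (Suc n) \<in> K (\<omega> n) \<rightarrow>\<^sub>M M (Suc (Suc n))"
      using measurable_cong_sets[OF setsK refl] by blast
    then show ?thesis
      unfolding N_def
      by (subst integral_distr) (auto intro: measurable_compose[OF coord f(1)])
  qed
  have "(\<integral>X. f (X (Suc n)) \<partial>markov_law \<mu> K) = (\<integral>\<omega>. f (\<omega> (Suc n)) \<partial>R (Suc (Suc n)))"
    unfolding R_def by (subst integral_distr[OF restr]) (auto intro: measurable_compose[OF coord f(1)])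
  also have "\<dots> = (\<integral>\<omega>. (\<integral>\<omega>'. f (\<omega>' (Suc n)) \<partial>N \<omega>) \<partial>R (Suc n))"
    unfolding R_Suc
  proof (rule integral_bind[OF _ _ N, where B' = 1])
    show "AE \<omega> in R (Suc n). emeasure (N \<omega>) (space (N \<omega>)) \<le> ennreal 1"
      using measurable_space[OF N]
      by (auto simp: space_subprob_algebra intro!: AE_I2 subprob_space.emeasure_space_le_1)
    show "finite_measure (R (Suc n))"
      using R_prob prob_space.finite_measure by blast
  qed (use f(2) in \<open>auto intro: measurable_compose[OF coord f(1)]\<close>)
  also have "\<dots> = (\<integral>\<omega>. (\<integral>s. f s \<partial>K (\<omega> n)) \<partial>R (Suc n))"
    by (intro Bochner_Integration.integral_cong inner refl)
  also have "\<dots> = (\<integral>X. (\<integral>s. f s \<partial>K (X n)) \<partial>markov_law \<mu> K)"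
  proof -
    have "(\<lambda>s. \<integral>t. f t \<partial>K s) \<in> borel_measurable borel"
      using measurable_compose[OF K(1) integral_measurable_subprob_algebra[OF f(1)]] .
    then have "(\<lambda>\<omega>. \<integral>s. f s \<partial>K (\<omega> n)) \<in> borel_measurable (M (Suc n))"
      using measurable_compose[OF coord[of n "Suc n"]] by simp
    then show ?thesis
      unfolding R_def by (subst integral_distr[OF restr]) auto
  qed
  finally show ?thesis .
qed

text \<open>This is the section of the projection with values in \<open>[0, 1)\<close>. It is not continuous at \<open>0\<close>, but the
  preimages of the half-lines \<open>(c, \<infinity>)\<close> are open.\<close>

lemma measurable_frac_rep: "(\<lambda>y. frac (rep_circle y)) \<in> borel_measurable borel"
proof (rule borel_measurableI_greater)
  fix c :: real
  have rep: "frac (rep_circle (to_circle t)) = frac t" for t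
  proof -
    have "rep_circle (to_circle t) - t \<in> \<int>"
      by (metis Quotient_abs_rep Quotient_circle to_circle_eq_iff)
    then obtain m where "rep_circle (to_circle t) = t + of_int m"
      by (metis Ints_cases add.commute diff_add_cancel)
    then show ?thesis
      by simp
  qed
  have "open {y. c < frac (rep_circle y)}"
  proof (cases "0 \<le> c")
    case True
    have "to_circle -` {y. c < frac (rep_circle y)} = (\<Union>m. {of_int m + c <..< of_int m + 1})"
    proof (intro set_eqI iffI)
      fix t assume "t \<in> to_circle -` {y. c < frac (rep_circle y)}"
      then have "c < frac t"
        by (simp add: rep)
      then have "t \<in> {of_int \<lfloor>t\<rfloor> + c <..< of_int \<lfloor>t\<rfloor> + 1}"
        by (auto simp: frac_def)
      then show "t \<in> (\<Union>m. {of_int m + c <..< of_int m + 1})"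
        by blast
    next
      fix t assume "t \<in> (\<Union>m. {of_int m + c <..< of_int m + 1})"
      then obtain m where m: "of_int m + c < t" "t < of_int m + 1"
        by auto
      then have "\<lfloor>t\<rfloor> = m"
        using True by (intro floor_unique) auto
      then have "c < frac t"
        using m by (simp add: frac_def)
      then show "t \<in> to_circle -` {y. c < frac (rep_circle y)}"
        by (simp add: rep)
    qed
    then show ?thesis
      by (auto simp: open_circle_def)
  next
    case False
    then have "c < frac t" for t
      using frac_ge_0[of t] by linarith
    then have "{y. c < frac (rep_circle y)} = UNIV"
      by blast
    then show ?thesis
      by simp
  qed
  then show "{y \<in> space borel. c < frac (rep_circle y)} \<in> sets borel"
    by simp
qed

text \<open>Measures on the circle lift to the interval \<open>[0, 1)\<close>, where Helly's selection theorem applies. A limit on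
  the line may charge the end point \<open>1\<close>; projecting it back to the circle is harmless.\<close>

lemma circle_weak_limit:
  fixes \<mu> :: "nat \<Rightarrow> circle measure"
  assumes \<mu>: "\<And>n. prob_space (\<mu> n)" "\<And>n. sets (\<mu> n) = sets borel"
  obtains r :: "nat \<Rightarrow> nat" and \<nu> where "strict_mono r" "prob_space \<nu>" "sets \<nu> = sets borel"
    "\<And>\<phi> :: circle \<Rightarrow> real. continuous_on UNIV \<phi> \<Longrightarrow> (\<lambda>n. \<integral>y. \<phi> y \<partial>\<mu> (r n)) \<longlonglongrightarrow> (\<integral>y. \<phi> y \<partial>\<nu>)"
proof -
  define s where "s y = frac (rep_circle y)" for y
  define M where "M n = distr (\<mu> n) borel s" for n
  have s: "s \<in> \<mu> n \<rightarrow>\<^sub>M borel" for n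
    using measurable_frac_rep measurable_cong_sets[OF \<mu>(2) refl] unfolding s_def[abs_def] by blast
  have s_range: "0 \<le> s y" "s y < 1" "to_circle (s y) = y" for y
    using Quotient_abs_rep[OF Quotient_circle] by (auto simp: s_def frac_lt_1)
  have M: "real_distribution (M n)" for n
    unfolding M_def using prob_space.real_distribution_distr[OF \<mu>(1) s] .
  have "tight M"
    unfolding tight_def
  proof (intro conjI allI impI M)
    fix \<epsilon> :: real assume "0 < \<epsilon>"
    have "measure (M n) {-1<..1} = 1" for n
    proof -
      interpret prob_space "\<mu> n"
        by (rule \<mu>)
      have "-1 < s y" "s y \<le> 1" for y
        using s_range(1,2)[of y] by linarith+
      then have "s -` {-1<..1} \<inter> space (\<mu> n) = space (\<mu> n)"
        by auto
      then show ?thesis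
        unfolding M_def by (subst measure_distr[OF s]) (auto simp: prob_space)
    qed
    then show "\<exists>a b. a < b \<and> (\<forall>n. 1 - \<epsilon> < measure (M n) {a<..b})"
      using \<open>0 < \<epsilon>\<close> by (intro exI[of _ "-1"] exI[of _ 1]) auto
  qed
  from tight_imp_convergent_subsubsequence[OF this strict_mono_id] obtain r M' where r: "strict_mono r"
    and M': "real_distribution M'" "weak_conv_m (M \<circ> id \<circ> r) M'"
    by blast
  interpret M': real_distribution M'
    by (rule M')
  have tc: "to_circle \<in> M' \<rightarrow>\<^sub>M borel"
    using borel_measurable_continuous_onI[OF continuous_on_to_circle] by simp
  show thesis
  proof (rule that[OF r])
    show "prob_space (distr M' borel to_circle)"
      by (rule M'.prob_space_distr[OF tc])
    fix \<phi> :: "circle \<Rightarrow> real" assume \<phi>: "continuous_on UNIV \<phi>"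
    obtain B where B: "\<And>y. \<bar>\<phi> y\<bar> \<le> B"
      using continuous_circle_bounded[OF \<phi>] by blast
    have lift: "continuous_on UNIV (\<lambda>t. \<phi> (to_circle t))"
      using \<phi> unfolding continuous_circle_iff .
    have "(\<lambda>n. \<integral>t. \<phi> (to_circle t) \<partial>(M \<circ> id \<circ> r) n) \<longlonglongrightarrow> (\<integral>t. \<phi> (to_circle t) \<partial>M')"
    proof (rule weak_conv_imp_integral_bdd_continuous_conv)
      show "isCont (\<lambda>t. \<phi> (to_circle t)) t" for t
        using lift by (simp add: continuous_on_eq_continuous_at)
    qed (use M M' B in \<open>simp_all add: comp_def\<close>)
    moreover have "(\<integral>t. \<phi> (to_circle t) \<partial>M n) = (\<integral>y. \<phi> y \<partial>\<mu> n)" for n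
      unfolding M_def using borel_measurable_continuous_onI[OF lift]
      by (subst integral_distr[OF s]) (auto simp: s_range)
    moreover have "(\<integral>t. \<phi> (to_circle t) \<partial>M') = (\<integral>y. \<phi> y \<partial>distr M' borel to_circle)"
      by (rule integral_distr[OF tc, symmetric]) (rule borel_measurable_continuous_onI[OF \<phi>])
    ultimately show "(\<lambda>n. \<integral>y. \<phi> y \<partial>\<mu> (r n)) \<longlonglongrightarrow> (\<integral>y. \<phi> y \<partial>distr M' borel to_circle)"
      by simp
  qed simp
qed

lemma LIMSEQ_if_subsubsequence:
  fixes u :: "nat \<Rightarrow> real"
  assumes "\<And>s :: nat \<Rightarrow> nat. strict_mono s \<Longrightarrow> \<exists>r :: nat \<Rightarrow> nat. strict_mono r \<and> (\<lambda>n. u (s (r n))) \<longlonglongrightarrow> l"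
  shows "u \<longlonglongrightarrow> l"
proof (rule ccontr)
  assume "\<not> u \<longlonglongrightarrow> l"
  then obtain e where e: "0 < e" "\<forall>N. \<exists>n\<ge>N. e \<le> dist (u n) l"
    unfolding lim_sequentially by (auto simp: not_less)
  then have "infinite {n. e \<le> dist (u n) l}"
    by (auto simp: infinite_nat_iff_unbounded_le)
  then obtain s :: "nat \<Rightarrow> nat" where s: "strict_mono s" "\<And>n. s n \<in> {n. e \<le> dist (u n) l}"
    using infinite_enumerate by blast
  obtain r :: "nat \<Rightarrow> nat" where "(\<lambda>n. u (s (r n))) \<longlonglongrightarrow> l"
    using assms[OF s(1)] by blast
  then obtain n where "dist (u (s (r n))) l < e"
    using e(1) unfolding lim_sequentially by blast
  then show False
    using s(2)[of "r n"] by simp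
qed

lemma LIMSEQ_if_even_odd:
  fixes u :: "nat \<Rightarrow> real"
  assumes "(\<lambda>n. u (2 * n)) \<longlonglongrightarrow> l" "(\<lambda>n. u (Suc (2 * n))) \<longlonglongrightarrow> l"
  shows "u \<longlonglongrightarrow> l"
proof (rule LIMSEQ_I)
  fix e :: real assume "0 < e"
  then obtain N N' where N: "\<And>n. N \<le> n \<Longrightarrow> norm (u (2 * n) - l) < e"
    "\<And>n. N' \<le> n \<Longrightarrow> norm (u (Suc (2 * n)) - l) < e"
    using assms[THEN LIMSEQ_D] by metis
  have "norm (u n - l) < e" if "2 * N + 2 * N' + 2 \<le> n" for n
  proof (cases "even n")
    case True
    then obtain k where "n = 2 * k"
      by (elim evenE)
    then show ?thesis
      using N(1)[of k] that by simp
  next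
    case False
    then obtain k where "n = Suc (2 * k)"
      by (elim oddE) simp
    then show ?thesis
      using N(2)[of k] that by simp
  qed
  then show "\<exists>no. \<forall>n\<ge>no. norm (u n - l) < e"
    by blast
qed


section \<open>The process on the circle\<close>

locale circle_chain =
  fixes p :: "circle \<Rightarrow> real" and \<alpha> :: real
  assumes cont_p: "continuous_on UNIV p" and p_pos: "\<And>y. 0 < p y" and p_less: "\<And>y. p y < 1"
begin

definition step :: "(circle \<Rightarrow> real) \<Rightarrow> circle \<Rightarrow> real"
  where "step \<phi> y = p y * \<phi> (y + to_circle \<alpha>) + (1 - p y) * \<phi> (y - to_circle \<alpha>)"

definition two_step_invariant :: "circle measure \<Rightarrow> bool"
  where "two_step_invariant \<mu> \<longleftrightarrow> prob_space \<mu> \<and> sets \<mu> = sets borel \<and>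
    (\<forall>\<phi>. continuous_on UNIV \<phi> \<longrightarrow> (\<integral>y. step (step \<phi>) y \<partial>\<mu>) = (\<integral>y. \<phi> y \<partial>\<mu>))"

lemma continuous_step:
  assumes "continuous_on UNIV \<phi>"
  shows "continuous_on UNIV (step \<phi>)"
  using continuous_circle_shift[OF assms, of "to_circle \<alpha>"]
    continuous_circle_shift[OF assms, of "- to_circle \<alpha>"]
  unfolding step_def[abs_def] by (auto intro!: continuous_intros cont_p)

lemma continuous_step_iterate:
  "continuous_on UNIV \<phi> \<Longrightarrow> continuous_on UNIV ((step ^^ n) \<phi>)"
  by (induction n) (auto intro: continuous_step)

lemma rotation_kernel_props:
  shows measurable_kernel: "rotation_kernel p \<alpha> \<in> borel \<rightarrow>\<^sub>M subprob_algebra borel"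
    and prob_space_kernel: "prob_space (rotation_kernel p \<alpha> y)"
proof -
  show "rotation_kernel p \<alpha> \<in> borel \<rightarrow>\<^sub>M subprob_algebra borel"
    using p_pos p_less by (intro measurable_rotation_kernel cont_p) (auto simp: less_imp_le)
  show "prob_space (rotation_kernel p \<alpha> y)"
    unfolding rotation_kernel_def by (intro prob_space.prob_space_distr prob_space_measure_pmf) simp
qed

lemma rotation_kernel_integral:
  assumes "continuous_on UNIV \<phi>"
  shows "(\<integral>z. \<phi> z \<partial>rotation_kernel p \<alpha> y) = step \<phi> y"
proof -
  have "(\<integral>z. \<phi> z \<partial>rotation_kernel p \<alpha> y)
      = (\<integral>b. \<phi> (if b then y + to_circle \<alpha> else y - to_circle \<alpha>) \<partial>bernoulli_pmf (p y))"
    unfolding rotation_kernel_def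
    by (rule integral_distr) (auto intro: borel_measurable_continuous_onI assms)
  then show ?thesis
    using p_pos[of y] p_less[of y] by (simp add: step_def less_imp_le mult.commute)
qed

lemma circle_law_expectation:
  assumes \<mu>: "prob_space \<mu>" "sets \<mu> = sets borel" and \<phi>: "continuous_on UNIV \<phi>"
  shows "(\<integral>X. \<phi> (X n) \<partial>circle_law p \<alpha> \<mu>) = (\<integral>y. (step ^^ n) \<phi> y \<partial>\<mu>)"
  using \<phi>
proof (induction n arbitrary: \<phi>)
  case 0
  have sets: "sets (markov_law \<mu> (rotation_kernel p \<alpha>)) = sets (PiM UNIV (\<lambda>_. borel))"
    using \<mu> measurable_kernel prob_space_kernel by (rule sets_markov_law)
  have "(\<lambda>X. X 0) \<in> markov_law \<mu> (rotation_kernel p \<alpha>) \<rightarrow>\<^sub>M borel"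
    unfolding measurable_cong_sets[OF sets refl] by (rule measurable_component_singleton) simp
  from integral_distr[OF this borel_measurable_continuous_onI[OF 0]] show ?case
    using markov_law_init[OF \<mu> measurable_kernel prob_space_kernel] by (simp add: circle_law_def)
next
  case (Suc n)
  obtain B where B: "\<And>y. \<bar>\<phi> y\<bar> \<le> B"
    using continuous_circle_bounded[OF Suc.prems] by blast
  have "(\<integral>X. \<phi> (X (Suc n)) \<partial>circle_law p \<alpha> \<mu>)
      = (\<integral>X. (\<integral>z. \<phi> z \<partial>rotation_kernel p \<alpha> (X n)) \<partial>circle_law p \<alpha> \<mu>)"
    unfolding circle_law_def
    by (rule markov_law_expectation_Suc[OF \<mu> measurable_kernel prob_space_kernel
          borel_measurable_continuous_onI[OF Suc.prems] B])
  then show ?case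
    using Suc.IH[OF continuous_step[OF Suc.prems]]
    by (simp add: rotation_kernel_integral[OF Suc.prems] funpow_swap1)
qed

lemma circle_law_marginal:
  assumes \<mu>: "prob_space \<mu>" "sets \<mu> = sets borel"
  obtains \<nu> where "prob_space \<nu>" "sets \<nu> = sets borel"
    "\<And>\<phi>. continuous_on UNIV \<phi> \<Longrightarrow> (\<integral>y. \<phi> y \<partial>\<nu>) = (\<integral>y. (step ^^ n) \<phi> y \<partial>\<mu>)"
proof -
  interpret prob_space "circle_law p \<alpha> \<mu>"
    unfolding circle_law_def using \<mu> measurable_kernel prob_space_kernel by (rule prob_space_markov_law)
  have sets: "sets (circle_law p \<alpha> \<mu>) = sets (PiM UNIV (\<lambda>_. borel))"
    unfolding circle_law_def using \<mu> measurable_kernel prob_space_kernel by (rule sets_markov_law)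
  have X: "(\<lambda>X. X n) \<in> circle_law p \<alpha> \<mu> \<rightarrow>\<^sub>M borel"
    unfolding measurable_cong_sets[OF sets refl] by (rule measurable_component_singleton) simp
  show thesis
  proof (rule that)
    show "prob_space (distr (circle_law p \<alpha> \<mu>) borel (\<lambda>X. X n))"
      by (rule prob_space_distr[OF X])
    fix \<phi> :: "circle \<Rightarrow> real" assume \<phi>: "continuous_on UNIV \<phi>"
    show "(\<integral>y. \<phi> y \<partial>distr (circle_law p \<alpha> \<mu>) borel (\<lambda>X. X n)) = (\<integral>y. (step ^^ n) \<phi> y \<partial>\<mu>)"
      using integral_distr[OF X borel_measurable_continuous_onI[OF \<phi>]]
        circle_law_expectation[OF \<mu> \<phi>] by simp
  qed simp
qed

lemma stationary_iff_step:
  "stationary p \<alpha> \<mu> \<longleftrightarrow> prob_space \<mu> \<and> sets \<mu> = sets borel \<and>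
    (\<forall>\<phi>. continuous_on UNIV \<phi> \<longrightarrow> (\<integral>y. step \<phi> y \<partial>\<mu>) = (\<integral>y. \<phi> y \<partial>\<mu>))"
proof (cases "prob_space \<mu> \<and> sets \<mu> = sets borel")
  case True
  then have expect: "(\<integral>X. \<phi> (X n) \<partial>circle_law p \<alpha> \<mu>) = (\<integral>y. (step ^^ n) \<phi> y \<partial>\<mu>)"
    if "continuous_on UNIV \<phi>" for \<phi> n
    using circle_law_expectation that by blast
  show ?thesis
  proof
    assume st: "stationary p \<alpha> \<mu>"
    have "(\<integral>y. step \<phi> y \<partial>\<mu>) = (\<integral>y. \<phi> y \<partial>\<mu>)" if \<phi>: "continuous_on UNIV \<phi>" for \<phi>
    proof -
      have "(\<integral>X. \<phi> (X 1) \<partial>circle_law p \<alpha> \<mu>) = (\<integral>X. \<phi> (X 0) \<partial>circle_law p \<alpha> \<mu>)"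
        using st \<phi> unfolding stationary_def by blast
      then show ?thesis
        unfolding expect[OF \<phi>] by simp
    qed
    then show "prob_space \<mu> \<and> sets \<mu> = sets borel \<and>
        (\<forall>\<phi>. continuous_on UNIV \<phi> \<longrightarrow> (\<integral>y. step \<phi> y \<partial>\<mu>) = (\<integral>y. \<phi> y \<partial>\<mu>))"
      using True by blast
  next
    assume *: "prob_space \<mu> \<and> sets \<mu> = sets borel \<and>
        (\<forall>\<phi>. continuous_on UNIV \<phi> \<longrightarrow> (\<integral>y. step \<phi> y \<partial>\<mu>) = (\<integral>y. \<phi> y \<partial>\<mu>))"
    have "(\<integral>y. (step ^^ n) \<phi> y \<partial>\<mu>) = (\<integral>y. \<phi> y \<partial>\<mu>)" if "continuous_on UNIV \<phi>" for \<phi> n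
      by (induction n) (use * continuous_step_iterate[OF that] in auto)
    then show "stationary p \<alpha> \<mu>"
      using True by (simp add: stationary_def expect)
  qed
qed (auto simp: stationary_def)

text \<open>The two-step walk returns to its starting point with the probability \<open>h\<close> below, which is at least \<open>\<epsilon>\<close> if
  every single transition has probability at least \<open>\<epsilon>\<close>.\<close>

lemma two_step_increments:
  assumes \<phi>: "continuous_on UNIV \<phi>"
  shows "(\<lambda>n. ((step \<circ> step) ^^ Suc n) \<phi> y - ((step \<circ> step) ^^ n) \<phi> y) \<longlonglongrightarrow> 0"
proof -
  obtain B where B: "\<And>y. \<bar>\<phi> y\<bar> \<le> B"
    using continuous_circle_bounded[OF \<phi>] by blast
  obtain m where m: "0 < m" "\<And>y. m \<le> p y"
    using continuous_circle_positive[OF cont_p p_pos] by blast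
  have "continuous_on UNIV (\<lambda>y. 1 - p y)"
    by (intro continuous_intros cont_p)
  then obtain m' where m': "0 < m'" "\<And>y. m' \<le> 1 - p y"
    using p_less continuous_circle_positive[of "\<lambda>y. 1 - p y"] by auto
  define \<epsilon> where "\<epsilon> = min m m'"
  have \<epsilon>: "0 < \<epsilon>" "\<And>y. \<epsilon> \<le> p y" "\<And>y. \<epsilon> \<le> 1 - p y"
    using m m' by (auto simp: \<epsilon>_def intro: min.coboundedI1 min.coboundedI2)
  show ?thesis
  proof (rule lazy_operator_increments[where \<epsilon> = \<epsilon> and B = B])
    show "(step \<circ> step) (\<lambda>y. f y - g y) = (\<lambda>y. (step \<circ> step) f y - (step \<circ> step) g y)" for f g
      by (simp add: step_def fun_eq_iff algebra_simps)
    show "\<epsilon> \<le> 1"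
      using \<epsilon>(2) p_less by (meson less_imp_le order_trans)
    fix f :: "circle \<Rightarrow> real" and M y assume M: "\<And>z. f z \<le> M"
    let ?c = "to_circle \<alpha>"
    define h where "h = p y * (1 - p (y + ?c)) + (1 - p y) * p (y - ?c)"
    have "p y * \<epsilon> + (1 - p y) * \<epsilon> \<le> h"
      unfolding h_def using \<epsilon> p_pos[of y] p_less[of y] by (intro add_mono mult_left_mono) (auto simp: less_imp_le)
    then have h: "\<epsilon> \<le> h"
      by (simp add: algebra_simps)
    have "(step \<circ> step) f y = p y * p (y + ?c) * f (y + ?c + ?c) + h * f y
        + (1 - p y) * (1 - p (y - ?c)) * f (y - ?c - ?c)"
      by (simp add: step_def h_def algebra_simps)
    also have "\<dots> \<le> p y * p (y + ?c) * M + h * f y + (1 - p y) * (1 - p (y - ?c)) * M"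
      using M p_pos p_less
      by (intro add_mono mult_left_mono mult_nonneg_nonneg order_refl) (auto simp: less_imp_le)
    also have "\<dots> = M - h * (M - f y)"
      by (simp add: h_def algebra_simps)
    also have "\<dots> \<le> M - \<epsilon> * (M - f y)"
      using h M[of y] by (intro diff_left_mono mult_right_mono) auto
    finally show "(step \<circ> step) f y \<le> \<epsilon> * f y + (1 - \<epsilon>) * M"
      by (simp add: algebra_simps)
  qed (use \<epsilon> B in auto)
qed

text \<open>Weak limits exist by compactness. They are stationary because replacing \<open>\<phi>\<close> by \<open>P\<^sup>2 \<phi>\<close> changes the
  expectations along the sequence by an increment, which tends to zero.\<close>

lemma two_step_limit:
  fixes s :: "nat \<Rightarrow> nat"
  assumes s: "strict_mono s"
  obtains r :: "nat \<Rightarrow> nat" and \<mu> where "strict_mono r" "two_step_invariant \<mu>"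
    "\<And>\<phi>. continuous_on UNIV \<phi> \<Longrightarrow> (\<lambda>n. ((step \<circ> step) ^^ s (r n)) \<phi> x) \<longlonglongrightarrow> (\<integral>y. \<phi> y \<partial>\<mu>)"
proof -
  have two: "(step ^^ (2 * n)) \<phi> = ((step \<circ> step) ^^ n) \<phi>" for n \<phi>
    by (induction n) auto
  have "\<exists>\<nu>. prob_space \<nu> \<and> sets \<nu> = sets borel \<and>
      (\<forall>\<phi>. continuous_on UNIV \<phi> \<longrightarrow> (\<integral>y. \<phi> y \<partial>\<nu>) = ((step \<circ> step) ^^ n) \<phi> x)" for n
  proof -
    have x: "prob_space (return borel x)" "sets (return borel x) = sets borel"
      by (auto intro: prob_space_return)
    have at_x: "(\<integral>y. \<phi> y \<partial>return borel x) = \<phi> x" if "continuous_on UNIV \<phi>" for \<phi> :: "circle \<Rightarrow> real"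
      using that by (intro integral_return borel_measurable_continuous_onI) auto
    show ?thesis
      using circle_law_marginal[OF x, of "2 * n"]
      by (metis at_x continuous_step_iterate two)
  qed
  then obtain law where law: "\<And>n. prob_space (law n)" "\<And>n. sets (law n) = sets borel"
    "\<And>n \<phi>. continuous_on UNIV \<phi> \<Longrightarrow> (\<integral>y. \<phi> y \<partial>law n) = ((step \<circ> step) ^^ n) \<phi> x"
    by metis
  obtain r \<mu> where r: "strict_mono r" and \<mu>: "prob_space \<mu>" "sets \<mu> = sets borel"
    and lim: "\<And>\<phi> :: circle \<Rightarrow> real. continuous_on UNIV \<phi> \<Longrightarrow> (\<lambda>n. \<integral>y. \<phi> y \<partial>law (s (r n))) \<longlonglongrightarrow> (\<integral>y. \<phi> y \<partial>\<mu>)"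
    using circle_weak_limit[of "\<lambda>n. law (s n)"] law by metis
  have "(\<integral>y. step (step \<phi>) y \<partial>\<mu>) = (\<integral>y. \<phi> y \<partial>\<mu>)" if \<phi>: "continuous_on UNIV \<phi>" for \<phi>
  proof -
    have sr: "strict_mono (\<lambda>n. s (r n))"
      using strict_mono_o[OF s r] by (simp add: comp_def)
    have c: "continuous_on UNIV (step (step \<phi>))"
      by (intro continuous_step \<phi>)
    have "(\<lambda>n. ((step \<circ> step) ^^ Suc (s (r n))) \<phi> x - ((step \<circ> step) ^^ s (r n)) \<phi> x) \<longlonglongrightarrow> 0"
      using LIMSEQ_subseq_LIMSEQ[OF two_step_increments[OF \<phi>] sr] by (simp add: comp_def)
    moreover have "(\<integral>y. step (step \<phi>) y \<partial>law n) - (\<integral>y. \<phi> y \<partial>law n)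
        = ((step \<circ> step) ^^ Suc n) \<phi> x - ((step \<circ> step) ^^ n) \<phi> x" for n
      using law(3)[OF \<phi>] law(3)[OF c] by (simp add: funpow_Suc_right del: funpow.simps)
    ultimately have "(\<lambda>n. (\<integral>y. step (step \<phi>) y \<partial>law (s (r n))) - (\<integral>y. \<phi> y \<partial>law (s (r n)))) \<longlonglongrightarrow> 0"
      by simp
    moreover have "(\<lambda>n. (\<integral>y. step (step \<phi>) y \<partial>law (s (r n))) - (\<integral>y. \<phi> y \<partial>law (s (r n))))
        \<longlonglongrightarrow> (\<integral>y. step (step \<phi>) y \<partial>\<mu>) - (\<integral>y. \<phi> y \<partial>\<mu>)"
      by (intro tendsto_diff lim c \<phi>)
    ultimately show ?thesis
      using LIMSEQ_unique by fastforce
  qed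
  then have "two_step_invariant \<mu>"
    using \<mu> by (simp add: two_step_invariant_def)
  then show thesis
    using that[OF r, of \<mu>] lim law(3) by simp
qed

text \<open>A single possible limit point forces convergence along the even times. If \<open>\<mu>\<close> is stationary for
  \<open>P\<^sup>2\<close>, so is its image under \<open>P\<close>; uniqueness makes \<open>\<mu>\<close> stationary for \<open>P\<close>, and the odd times follow by
  applying the even case to \<open>P \<phi>\<close>.\<close>

theorem mixing_if_two_step_unique:
  assumes unique: "\<And>\<mu> \<nu>. two_step_invariant \<mu> \<Longrightarrow> two_step_invariant \<nu> \<Longrightarrow> \<mu> = \<nu>"
  shows "\<exists>\<mu>. stationary p \<alpha> \<mu> \<and> (\<forall>\<nu>. stationary p \<alpha> \<nu> \<longrightarrow> \<nu> = \<mu>) \<and>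
    (\<forall>\<phi> :: circle \<Rightarrow> real. continuous_on UNIV \<phi> \<longrightarrow>
      (\<lambda>n. \<integral>X. \<phi> (X n) \<partial>circle_law p \<alpha> (return borel x)) \<longlonglongrightarrow> (\<integral>y. \<phi> y \<partial>\<mu>))"
proof -
  obtain \<mu> where \<mu>: "two_step_invariant \<mu>"
    using two_step_limit[OF strict_mono_id, of x] by blast
  then have mu: "prob_space \<mu>" "sets \<mu> = sets borel"
    by (simp_all add: two_step_invariant_def)
  have even: "(\<lambda>n. ((step \<circ> step) ^^ n) \<phi> x) \<longlonglongrightarrow> (\<integral>y. \<phi> y \<partial>\<mu>)" if \<phi>: "continuous_on UNIV \<phi>" for \<phi>
  proof (rule LIMSEQ_if_subsubsequence)
    fix s :: "nat \<Rightarrow> nat" assume "strict_mono s"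
    from two_step_limit[OF this, of x] obtain r \<nu> where "strict_mono r" "two_step_invariant \<nu>"
      "(\<lambda>n. ((step \<circ> step) ^^ s (r n)) \<phi> x) \<longlonglongrightarrow> (\<integral>y. \<phi> y \<partial>\<nu>)"
      using \<phi> by metis
    then show "\<exists>r. strict_mono r \<and> (\<lambda>n. ((step \<circ> step) ^^ s (r n)) \<phi> x) \<longlonglongrightarrow> (\<integral>y. \<phi> y \<partial>\<mu>)"
      using unique[OF \<mu>] by blast
  qed
  obtain \<mu>' where mu': "prob_space \<mu>'" "sets \<mu>' = sets borel"
    "\<And>\<phi>. continuous_on UNIV \<phi> \<Longrightarrow> (\<integral>y. \<phi> y \<partial>\<mu>') = (\<integral>y. step \<phi> y \<partial>\<mu>)"
    using circle_law_marginal[OF mu, of 1] by auto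
  have "two_step_invariant \<mu>'"
    using mu' \<mu> continuous_step unfolding two_step_invariant_def by simp
  then have one: "(\<integral>y. step \<phi> y \<partial>\<mu>) = (\<integral>y. \<phi> y \<partial>\<mu>)" if "continuous_on UNIV \<phi>" for \<phi>
    using unique[OF \<mu>] mu'(3)[OF that] by simp
  have "stationary p \<alpha> \<mu>"
    using mu one by (simp add: stationary_iff_step)
  moreover have "\<nu> = \<mu>" if "stationary p \<alpha> \<nu>" for \<nu>
    using that unique[OF _ \<mu>, of \<nu>] continuous_step
    unfolding stationary_iff_step two_step_invariant_def by simp
  moreover have "(\<lambda>n. \<integral>X. \<phi> (X n) \<partial>circle_law p \<alpha> (return borel x)) \<longlonglongrightarrow> (\<integral>y. \<phi> y \<partial>\<mu>)"
    if \<phi>: "continuous_on UNIV \<phi>" for \<phi> :: "circle \<Rightarrow> real"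
  proof -
    have expect: "(\<integral>X. \<phi> (X n) \<partial>circle_law p \<alpha> (return borel x)) = (step ^^ n) \<phi> x" for n
    proof -
      have "(\<integral>X. \<phi> (X n) \<partial>circle_law p \<alpha> (return borel x)) = (\<integral>y. (step ^^ n) \<phi> y \<partial>return borel x)"
        by (intro circle_law_expectation \<phi>) (auto intro: prob_space_return)
      also have "\<dots> = (step ^^ n) \<phi> x"
        by (intro integral_return borel_measurable_continuous_onI continuous_step_iterate \<phi>) auto
      finally show ?thesis .
    qed
    have two: "(step ^^ (2 * n)) f = ((step \<circ> step) ^^ n) f" for n f
      by (induction n) auto
    show ?thesis
      unfolding expect
    proof (rule LIMSEQ_if_even_odd)
      show "(\<lambda>n. (step ^^ (2 * n)) \<phi> x) \<longlonglongrightarrow> (\<integral>y. \<phi> y \<partial>\<mu>)"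
        using even[OF \<phi>] by (simp add: two)
      show "(\<lambda>n. (step ^^ Suc (2 * n)) \<phi> x) \<longlonglongrightarrow> (\<integral>y. \<phi> y \<partial>\<mu>)"
        using even[OF continuous_step[OF \<phi>]] one[OF \<phi>]
        by (simp add: funpow_Suc_right two del: funpow.simps)
    qed
  qed
  ultimately show ?thesis
    by blast
qed

end

text \<open>The log-odds \<open>ln s - ln (1 - s)\<close> is the sum of two increasing functions of \<open>s\<close>, so its increment
  dominates that of each of them. This carries bounded variation from \<open>log (p/q)\<close> over to \<open>log p\<close> and
  \<open>log q\<close> separately, which occur with different shifts in the two-step rates.\<close>

lemma abs_diff_ln_le:
  fixes s t :: real
  assumes "0 < s" "s < 1" "0 < t" "t < 1"
  shows "\<bar>ln s - ln t\<bar> \<le> \<bar>ln (s / (1 - s)) - ln (t / (1 - t))\<bar>"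
    and "\<bar>ln (1 - s) - ln (1 - t)\<bar> \<le> \<bar>ln (s / (1 - s)) - ln (t / (1 - t))\<bar>"
proof -
  have "ln s \<le> ln t \<longleftrightarrow> s \<le> t" "ln (1 - s) \<le> ln (1 - t) \<longleftrightarrow> t \<le> s"
    "ln t \<le> ln s \<longleftrightarrow> t \<le> s" "ln (1 - t) \<le> ln (1 - s) \<longleftrightarrow> s \<le> t"
    using assms by simp_all
  moreover have "ln (s / (1 - s)) = ln s - ln (1 - s)" "ln (t / (1 - t)) = ln t - ln (1 - t)"
    using assms by (simp_all add: ln_div)
  ultimately show "\<bar>ln s - ln t\<bar> \<le> \<bar>ln (s / (1 - s)) - ln (t / (1 - t))\<bar>"
    "\<bar>ln (1 - s) - ln (1 - t)\<bar> \<le> \<bar>ln (s / (1 - s)) - ln (t / (1 - t))\<bar>"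
    by linarith+
qed

theorem theorem2:
  fixes \<alpha> :: real and p :: "circle \<Rightarrow> real" and x :: circle
  assumes "\<alpha> \<notin> \<rat>"
    and "continuous_on UNIV p"
    and "\<And>y. 0 < p y \<and> p y < 1"
    and "(\<integral>y. ln (p y / (1 - p y)) \<partial>circle_lebesgue) = 0"
    and "continuous_on UNIV (\<lambda>y. ln (p y / (1 - p y)))"
    and "bounded_variation_circle (\<lambda>y. ln (p y / (1 - p y)))"
    and "(\<lambda>n. \<Sum>\<^sub>\<infinity>k\<in>UNIV. measure (walk_law p \<alpha> x)
            {\<xi> \<in> space (walk_law p \<alpha> x). ladder_time k \<xi> = enat n}) \<longlonglongrightarrow> 0"
  shows "\<exists>\<mu>. stationary p \<alpha> \<mu> \<and> (\<forall>\<nu>. stationary p \<alpha> \<nu> \<longrightarrow> \<nu> = \<mu>) \<and>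
    (\<forall>\<phi> :: circle \<Rightarrow> real. continuous_on UNIV \<phi> \<longrightarrow>
      (\<lambda>n. \<integral>X. \<phi> (X n) \<partial>circle_law p \<alpha> (return borel x)) \<longlonglongrightarrow> (\<integral>y. \<phi> y \<partial>\<mu>))"
proof -
  interpret chain: circle_chain p \<alpha>
    using assms(2,3) by unfold_locales auto
  define lp where "lp y = ln (p y)" for y
  define q where "q y = 1 - p y" for y
  define lq where "lq y = ln (q y)" for y
  have q_pos: "0 < q y" and q_less: "q y < 1" for y
    using assms(3) by (simp_all add: q_def)
  \<comment> \<open>The logarithm of the ratio of the two-step rates \<open>a\<close> and \<open>b\<close> below.\<close>
  define V where "V y = (lp y + lp (y + to_circle \<alpha>)) + (- lq y + - lq (y + to_circle (- \<alpha>)))" for y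
  have cont_lp: "continuous_on UNIV lp" and cont_lq: "continuous_on UNIV lq"
    unfolding lp_def[abs_def] lq_def[abs_def] q_def using assms(3)
    by (auto intro!: continuous_intros assms(2) simp: less_imp_neq less_imp_neq[symmetric])
  obtain T W where T: "variation_majorant T W (\<lambda>y. ln (p y / (1 - p y)))"
    using variation_majorant_exists[OF assms(6)] by blast
  have lp: "variation_majorant T W lp"
    using T by (rule variation_majorant_contraction) (use assms(3) in \<open>simp add: lp_def abs_diff_ln_le\<close>)
  have lq: "variation_majorant T W (\<lambda>y. - lq y)"
    using T
  proof (rule variation_majorant_contraction)
    show "\<bar>- lq y - - lq z\<bar> \<le> \<bar>ln (p y / (1 - p y)) - ln (p z / (1 - p z))\<bar>" for y z
      using abs_diff_ln_le(2)[of "p y" "p z"] assms(3) by (simp add: lq_def q_def abs_minus_commute)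
  qed
  obtain T' W' where T': "variation_majorant T' W' V"
    using variation_majorant_add[OF
        variation_majorant_add[OF lp variation_majorant_translate[OF lp, of \<alpha>]]
        variation_majorant_add[OF lq variation_majorant_translate[OF lq, of "- \<alpha>"]]]
    unfolding V_def[abs_def] by blast
  interpret leb: prob_space circle_lebesgue
    by (rule prob_space_circle_lebesgue)
  have int: "integrable circle_lebesgue (\<lambda>y. lp (y + c))" "integrable circle_lebesgue (\<lambda>y. lq (y + c))" for c
    using continuous_circle_integrable[OF _ sets_circle_lebesgue leb.finite_measure_axioms]
      continuous_circle_shift cont_lp cont_lq by blast+
  have "(\<integral>y. lp y - lq y \<partial>circle_lebesgue) = 0"
    using assms(3,4) by (simp add: lp_def lq_def q_def ln_div less_imp_neq[symmetric])
  then have mean: "(\<integral>y. V y \<partial>circle_lebesgue) = 0"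
    using int int[of 0] by (simp add: V_def circle_lebesgue_shift[OF cont_lp] circle_lebesgue_shift[OF cont_lq])
  define a where "a y = p y * p (y + to_circle \<alpha>)" for y
  define b where "b y = q y * q (y + to_circle (- \<alpha>))" for y
  interpret walk: rotation_walk "2 * \<alpha>" a b V T' W'
  proof
    show "2 * \<alpha> \<notin> \<rat>"
    proof
      assume "2 * \<alpha> \<in> \<rat>"
      then have "2 * \<alpha> / 2 \<in> \<rat>"
        by (intro Rats_divide) auto
      then show False
        using assms(1) by simp
    qed
    show "continuous_on UNIV a" "continuous_on UNIV b"
      unfolding a_def[abs_def] b_def[abs_def] q_def
      by (intro continuous_intros continuous_circle_shift assms(2))+
    show "continuous_on UNIV V"
      unfolding V_def[abs_def] by (intro continuous_intros continuous_circle_shift cont_lp cont_lq)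
    show "0 < b y" for y
      using q_pos by (simp add: b_def)
    have "exp (lp y) = p y" "exp (lq y) = q y" "q y \<noteq> 0" for y
      using assms(3) q_pos[of y] by (simp_all add: lp_def lq_def)
    then show "exp (V y) * b y = a y" for y
      by (simp add: a_def b_def V_def exp_add exp_minus exp_diff field_simps)
  qed (fact T' mean)+
  have double: "to_circle (2 * \<alpha>) = to_circle \<alpha> + to_circle \<alpha>"
    by (simp only: mult_2 to_circle_add)
  have "chain.two_step_invariant \<mu> \<Longrightarrow> walk.invariant \<mu>" for \<mu>
  proof -
    assume \<mu>: "chain.two_step_invariant \<mu>"
    then interpret prob_space \<mu>
      by (simp add: chain.two_step_invariant_def)
    have "(\<integral>y. walk.generator \<phi> y \<partial>\<mu>) = 0" if \<phi>: "continuous_on UNIV \<phi>" for \<phi>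
    proof -
      have "walk.generator \<phi> y = chain.step (chain.step \<phi>) y - \<phi> y" for y
        unfolding walk.generator_def double unfolding chain.step_def a_def b_def q_def
        by (simp add: to_circle_minus to_circle_add algebra_simps)
      moreover have "integrable \<mu> f" if "continuous_on UNIV f" for f :: "circle \<Rightarrow> real"
        using continuous_circle_integrable[OF that _ finite_measure_axioms] \<mu>
        by (simp add: chain.two_step_invariant_def)
      ultimately show ?thesis
        using \<mu> \<phi> chain.continuous_step by (simp add: chain.two_step_invariant_def)
    qed
    then show "walk.invariant \<mu>"
      using \<mu> by (simp add: walk.invariant_def chain.two_step_invariant_def)
  qed
  then show ?thesis
    using walk.invariant_unique by (intro chain.mixing_if_two_step_unique) blast
qed

end
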